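(* Let $\boldsymbol X$ be a random vector on $[0,\infty)^d$ with $F\in\mathcal{RV}(1/\gamma)$, $\gamma\in(0,1)$, satisfying the density assumptions and Condition 1 below. Then for each $j\in\{1,\dots,d\}$ there is a constant $c_j\in\mathbb R$ such that, with $\tau=1-1/t$, $$A_{X_j}\big(U_{X_j}(t)\big)^{-1}\left(\frac{\theta_j(\tau)}{Q_R(\tau)\,\overline w_j/(1-\gamma)}-1\right)\to c_j,\qquad t\to\infty.$$
   Context: Notation: $R=X_1+\dots+X_d$, $\mathcal S=\{\boldsymbol w\in[0,\infty)^d:\|\boldsymbol w\|_1=1\}$, $\boldsymbol W=R^{-1}\boldsymbol X$; for a random variable $Y$ with distribution $F_Y$, $U_Y(t)=\inf\{x:F_Y(x)\ge1-1/t\}$, $Q_Y(\tau)=U_Y(1/(1-\tau))$; $\theta_j(\tau)=\mathbb E(X_j\mid R>Q_R(\tau))$. $F\in\mathcal{RV}(1/\gamma)$ means $\mathbb P(R>x)$ is regularly varying with index $-1/\gamma$ and $\mathbb P(\boldsymbol W\in\cdot\mid R>t)\to H$ weakly on $\mathcal S$ as $t\to\infty$ for a probability measure $H$ (angular measure); $\overline w_j=\int_{\mathcal S}w_j\,H(\mathrm d\boldsymbol w)$. Density assumptions: $F$ has a density $f$ and $H$ has a bounded continuous density $h:\mathcal S\to(0,\infty)$ with $\lim_{t\to\infty}\sup_{\boldsymbol w\in\mathcal S}\big|t^d f(t\boldsymbol w)/\mathbb P(R>t)-h(\boldsymbol w)/\gamma\big|=0$. For $\boldsymbol x\in(0,\infty)^d$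 write $r=\|\boldsymbol x\|_1$, $\boldsymbol w=\boldsymbol x/r$. Condition 1: for some $\rho<0$ and every $j\in\{1,\dots,d\}$: (a) there is a function $A_{X_j}$ with $\lim_{t\to\infty}t^{-\rho}A_{X_j}(t)\in\mathbb R\setminus\{0\}$ and, for all $x>0$, $$\lim_{t\to\infty}\frac{\frac{1-F_{X_j}(tx)}{1-F_{X_j}(t)}-x^{-1/\gamma}}{A_{X_j}(t)}=x^{-1/\gamma}\frac{x^\rho-1}{\rho};$$ (b) there is a nonnull function $\lambda_j$, integrable on sets bounded away from zero, with $\sup_{\boldsymbol w\in\mathcal S}|\lambda_j(\boldsymbol w)|<\infty$, and a function $q_j(\boldsymbol x)\propto r^{-d-1/\gamma}h(\boldsymbol w)$, such that $$\lim_{t\to\infty}\frac{\frac{t^df(t\boldsymbol x)}{\mathbb P(X_j>t)}-q_j(\boldsymbol x)}{A_{X_j}(t)}=\lambda_j(\boldsymbol x)\quad\forall\boldsymbol x\in(0,\infty)^d,$$ and $\lim_{t\to\infty}\sup_{\boldsymbol w\in\mathcal S}\Big|\frac{t^df(t\boldsymbol w)/\mathbb P(X_j>t)-q_j(\boldsymbol w)}{A_{X_j}(t)}-\lambda_j(\boldsymbol w)\Big|=0$. *)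

theory Defs
  imports "HOL-Probability.Probability"
begin

text \<open>Radial part R = x_1 + ... + x_d (the L1 norm on the nonnegative orthant).\<close>
definition Rsum :: "real^'d \<Rightarrow> real" where
  "Rsum x = (\<Sum>j\<in>UNIV. x $ j)"

definition unit_simplex :: "(real^'d) set" where
  "unit_simplex = {w. (\<forall>j. 0 \<le> w $ j) \<and> Rsum w = 1}"

text \<open>Reference measure on the simplex: (d-1)-dimensional Lebesgue measure of the
  projection onto d-1 coordinates, written as the cone measure
  sigma(B) = d * Leb_d {x >= 0 : 0 < R x <= 1, x / R x in B}.\<close>
definition simplex_measure :: "(real^'d) measure" where
  "simplex_measure = scale_measure (of_nat CARD('d))
     (distr (restrict_space lborel {x. (\<forall>j. 0 \<le> x $ j) \<and> 0 < Rsum x \<and> Rsum x \<le> 1})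
        borel (\<lambda>x. (1 / Rsum x) *\<^sub>R x))"

definition cdf_rv :: "'a measure \<Rightarrow> ('a \<Rightarrow> real) \<Rightarrow> real \<Rightarrow> real" where
  "cdf_rv M Y x = measure M {\<omega>\<in>space M. Y \<omega> \<le> x}"

definition tailq :: "'a measure \<Rightarrow> ('a \<Rightarrow> real) \<Rightarrow> real \<Rightarrow> real" where
  "tailq M Y t = Inf {x. cdf_rv M Y x \<ge> 1 - 1 / t}"

definition quantile :: "'a measure \<Rightarrow> ('a \<Rightarrow> real) \<Rightarrow> real \<Rightarrow> real" where
  "quantile M Y \<tau> = tailq M Y (1 / (1 - \<tau>))"

definition cond_mean :: "'a measure \<Rightarrow> ('a \<Rightarrow> real) \<Rightarrow> 'a set \<Rightarrow> real" where
  "cond_mean M Y A = (\<integral>\<omega>. indicator A \<omega> * Y \<omega> \<partial>M) / measure M A"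

end

theory Submission
  imports Defs
begin

text \<open>The second-order condition with \<open>A t \<sim> c * t powr \<rho>\<close> forces the expansion
  \<open>P(X\<^sub>j > t) = t powr (-1/\<gamma>) * (C + b * t powr \<rho> + o(t powr \<rho>))\<close>. Together with the uniform
  convergence on the simplex it yields, uniformly in \<open>w\<close>,
  \<open>f (t w) = t powr (-d - 1/\<gamma>) * (C \<kappa> h w + t powr \<rho> * (g w + o(1)))\<close> with \<open>g\<close> bounded.
  Integrating in polar coordinates gives two-term expansions of \<open>P(R > u)\<close> and
  \<open>E(X\<^sub>j; R > u)\<close>, hence of their quotient, with relative error of order \<open>u powr \<rho>\<close>. Finally the
  quantiles of \<open>R\<close> and of \<open>X\<^sub>j\<close> are both asymptotic to multiples of \<open>t powr \<gamma>\<close>, so that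
  \<open>A\<close> at the quantile of \<open>X\<^sub>j\<close> is asymptotic to a multiple of \<open>u powr \<rho>\<close> at the quantile \<open>u\<close> of \<open>R\<close>.\<close>

section \<open>Second-order expansions of tails and quantiles\<close>

text \<open>Condition 1(b) normalises the density by \<open>P(X_j > t)\<close>, of which Condition
  1(a) controls only ratios. Replacing this normaliser by a pure power is harmless at order
  \<open>t powr \<rho>\<close> only if the tail itself has two terms, so the tail is treated before
  any density is integrated. The ratio limits are pointwise in \<open>x\<close>, but doubling alone
  yields the rate: since \<rho> is negative, the increments of the log tail over successive
  doublings are summable. In polar coordinates both terms of the density are homogeneous and
  integrate exactly, and the error is dominated by a homogeneous function as well. For
  \<open>X_j\<close> the extra factor \<open>r\<close> lowers the exponent
  \<open>1 / \<gamma>\<close> to \<open>1 / \<gamma> - 1\<close>, which is positive because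
  \<open>\<gamma> < 1\<close>. The quotient of these two exponents is
  \<open>1 / (1 - \<gamma>)\<close>, the constant in the statement, and the unknown factor \<kappa>
  cancels in the leading term. The limit found is
  \<open>(a0 * b1 - a1 * b0) / (a1 * a0) * (k powr \<rho> / c)\<close>, where \<open>k\<close> is
  the limit of the ratio of the two quantiles, \<open>c\<close> is that of
  \<open>t powr (- \<rho>) * A t\<close>, and \<open>b0\<close>, \<open>b1\<close> are the
  second-order coefficients.\<close>

lemma tendsto_deriv_scaled:
  fixes \<phi> :: "real \<Rightarrow> real"
  assumes "(\<phi> has_real_derivative D) (at 0)" "\<phi> 0 = 0"
    and r: "(r \<longlongrightarrow> 0) F" and "eventually (\<lambda>t. r t \<noteq> 0) F"
    and y: "((\<lambda>t. y t / r t) \<longlongrightarrow> k) F"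
  shows "((\<lambda>t. \<phi> (y t) / r t) \<longlongrightarrow> D * k) F"
proof -
  \<comment> \<open>Caratheodory's form of the derivative avoids the quotient
    \<open>\<phi> y / y\<close>, which would be useless where \<open>y t = 0\<close>.\<close>
  obtain g where g: "\<And>z. \<phi> z - \<phi> 0 = g z * (z - 0)" "isCont g 0" "g 0 = D"
    using assms(1) unfolding CARAT_DERIV by auto
  have "((\<lambda>t. y t / r t * r t) \<longlongrightarrow> k * 0) F"
    by (intro tendsto_intros r y)
  then have "((\<lambda>t. y t / r t * r t) \<longlongrightarrow> 0) F" by simp
  then have "(y \<longlongrightarrow> 0) F"
    by (rule Lim_transform_eventually) (use assms(4) in \<open>eventually_elim, simp\<close>)
  then have "((\<lambda>t. g (y t)) \<longlongrightarrow> D) F"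
    using g(2,3) isCont_tendsto_compose by metis
  then have "((\<lambda>t. g (y t) * (y t / r t)) \<longlongrightarrow> D * k) F"
    by (intro tendsto_intros y)
  moreover have "\<phi> (y t) / r t = g (y t) * (y t / r t)" for t
    using g(1)[of "y t"] assms(2) by simp
  ultimately show ?thesis by (simp only:)
qed

text \<open>Along \<open>2 ^ i * t\<close> the increments of \<open>l\<close> are dominated by a geometric series, which gives
  the limit and its rate; slow variation makes the limits along these sequences agree.\<close>
lemma log_tail_expansion:
  fixes l :: "real \<Rightarrow> real"
  assumes rho: "\<rho> < 0"
    and rate: "((\<lambda>t. (l (2 * t) - l t) / t powr \<rho>) \<longlongrightarrow> \<delta>) at_top"
    and slow: "\<And>x. x > 0 \<Longrightarrow> ((\<lambda>t. l (t * x) - l t) \<longlongrightarrow> 0) at_top"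
  shows "\<exists>c. ((\<lambda>t. (l t - c) / t powr \<rho>) \<longlongrightarrow> - \<delta> / (1 - 2 powr \<rho>)) at_top"
proof -
  define b where "b = (2::real) powr \<rho>"
  have b: "0 < b" "b < 1"
    using rho unfolding b_def by (auto simp: powr_less_one)
  have pw: "(2 ^ i * t) powr \<rho> = t powr \<rho> * b ^ i" if "t > 0" for t and i :: nat
    using that by (simp add: powr_mult b_def powr_realpow[symmetric] powr_powr mult.commute)
  \<comment> \<open>\<open>S\<close> is the total increment of \<open>l\<close> along the doublings
    of \<open>t\<close>. After division by \<open>t powr \<rho>\<close> its terms differ from
    \<open>\<delta> * b ^ i\<close> by at most \<open>e * b ^ i\<close>, and these errors sum to
    \<open>e / (1 - b)\<close> whatever \<open>t \<ge> T\<close> is.\<close>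
  have main: "\<exists>T>0. \<forall>t\<ge>T. \<exists>S. ((\<lambda>i. l (2 ^ i * t)) \<longlonglongrightarrow> l t + S) \<and>
      \<bar>S / t powr \<rho> - \<delta> / (1 - b)\<bar> \<le> e / (1 - b)" if e: "e > 0" for e
  proof -
    from tendstoD[OF rate e] obtain T0 where
      T0: "\<And>t. t \<ge> T0 \<Longrightarrow> dist ((l (2 * t) - l t) / t powr \<rho>) \<delta> < e"
      unfolding eventually_at_top_linorder by blast
    define T where "T = max T0 1"
    have "\<exists>S. ((\<lambda>i. l (2 ^ i * t)) \<longlonglongrightarrow> l t + S) \<and> \<bar>S / t powr \<rho> - \<delta> / (1 - b)\<bar> \<le> e / (1 - b)"
      if t: "t \<ge> T" for t
    proof -
      have tpos: "t > 0" using t unfolding T_def by simp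
      define d where "d i = l (2 ^ Suc i * t) - l (2 ^ i * t)" for i :: nat
      have dd: "\<bar>d i / t powr \<rho> - \<delta> * b ^ i\<bar> \<le> e * b ^ i" for i
      proof -
        have "2 ^ i * t \<ge> 1 * t" by (intro mult_right_mono) (use tpos in auto)
        then have "2 ^ i * t \<ge> T0" using t unfolding T_def by linarith
        from T0[OF this] have "\<bar>d i / (t powr \<rho> * b ^ i) - \<delta>\<bar> \<le> e"
          unfolding d_def dist_real_def pw[OF tpos] by (simp add: mult_ac)
        then have "\<bar>d i / (t powr \<rho> * b ^ i) - \<delta>\<bar> * b ^ i \<le> e * b ^ i"
          by (intro mult_right_mono) (use b in auto)
        also have "\<bar>d i / (t powr \<rho> * b ^ i) - \<delta>\<bar> * b ^ i = \<bar>(d i / (t powr \<rho> * b ^ i) - \<delta>) * b ^ i\<bar>"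
          using b by (simp add: abs_mult)
        also have "(d i / (t powr \<rho> * b ^ i) - \<delta>) * b ^ i = d i / t powr \<rho> - \<delta> * b ^ i"
          using b by (simp add: field_simps)
        finally show ?thesis .
      qed
      have geo: "(\<lambda>i. c * b ^ i) sums (c / (1 - b))" for c
        using sums_mult[OF geometric_sums[of b], of c] b by simp
      have sm: "summable (\<lambda>i. d i / t powr \<rho> - \<delta> * b ^ i)"
        by (rule summable_comparison_test[OF _ sums_summable[OF geo[of e]]])
           (use dd in \<open>auto intro!: exI[of _ 0]\<close>)
      have "\<bar>\<Sum>i. d i / t powr \<rho> - \<delta> * b ^ i\<bar> \<le> (\<Sum>i. e * b ^ i)"
        using norm_suminf_le[of "\<lambda>i. d i / t powr \<rho> - \<delta> * b ^ i" "\<lambda>i. e * b ^ i"]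
          dd sums_summable[OF geo[of e]] by simp
      also have "\<dots> = e / (1 - b)"
        using sums_unique[OF geo[of e]] by simp
      finally have bound: "\<bar>\<Sum>i. d i / t powr \<rho> - \<delta> * b ^ i\<bar> \<le> e / (1 - b)" .
      from sums_add[OF summable_sums[OF sm] geo[of \<delta>]]
      have "(\<lambda>i. d i / t powr \<rho>) sums ((\<Sum>i. d i / t powr \<rho> - \<delta> * b ^ i) + \<delta> / (1 - b))"
        by simp
      then have 1: "(\<lambda>i. d i / t powr \<rho> * t powr \<rho>) sums
          (((\<Sum>i. d i / t powr \<rho> - \<delta> * b ^ i) + \<delta> / (1 - b)) * t powr \<rho>)" (is "_ sums ?S")
        by (rule sums_mult2)
      then have "d sums ?S" using tpos by simp
      then have "(\<lambda>n. \<Sum>i<n. d i) \<longlonglongrightarrow> ?S" unfolding sums_def .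
      moreover have "(\<Sum>i<n. d i) = l (2 ^ n * t) - l t" for n
        unfolding d_def by (subst sum_lessThan_telescope) simp
      ultimately have "(\<lambda>n. l t + (l (2 ^ n * t) - l t)) \<longlonglongrightarrow> l t + ?S"
        by (intro tendsto_intros) simp
      then show ?thesis using bound tpos by (intro exI[of _ ?S]) simp
    qed
    then show ?thesis by (intro exI[of _ T]) (auto simp: T_def)
  qed
  obtain T1 where T1: "T1 > 0" "\<forall>t\<ge>T1. \<exists>S. ((\<lambda>i. l (2 ^ i * t)) \<longlonglongrightarrow> l t + S)"
    using main[of 1] by (auto; metis)
  obtain c where c: "(\<lambda>i. l (2 ^ i * T1)) \<longlonglongrightarrow> c" using T1 by blast
  have same: "(\<lambda>i. l (2 ^ i * t)) \<longlonglongrightarrow> c" if "t > 0" for t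
  proof -
    have "filterlim (\<lambda>i::nat. T1 * (2::real) ^ i) at_top at_top"
      by (rule filterlim_tendsto_pos_mult_at_top[OF tendsto_const T1(1)])
         (rule filterlim_at_top_mono[OF filterlim_real_sequentially], simp add: less_imp_le[OF of_nat_less_two_power])
    then have "(\<lambda>i. l (T1 * 2 ^ i * (t / T1)) - l (T1 * 2 ^ i)) \<longlonglongrightarrow> 0"
      by (intro filterlim_compose[OF slow[of "t / T1"]]) (use T1(1) that in auto)
    then have "(\<lambda>i. (l (2 ^ i * t) - l (2 ^ i * T1)) + l (2 ^ i * T1)) \<longlonglongrightarrow> 0 + c"
      using T1(1) by (intro tendsto_add c) (simp add: mult_ac)
    then show ?thesis by simp
  qed
  have "((\<lambda>t. (l t - c) / t powr \<rho>) \<longlongrightarrow> - \<delta> / (1 - b)) at_top"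
  proof (rule tendstoI)
    fix e :: real assume e: "e > 0"
    obtain T where T: "T > 0" "\<And>t. t \<ge> T \<Longrightarrow> \<exists>S. ((\<lambda>i. l (2 ^ i * t)) \<longlonglongrightarrow> l t + S) \<and>
      \<bar>S / t powr \<rho> - \<delta> / (1 - b)\<bar> \<le> (e / 2 * (1 - b)) / (1 - b)"
      using main[of "e / 2 * (1 - b)"] e b by auto
    have cancel: "(e / 2 * (1 - b)) / (1 - b) = e / 2"
      by (rule nonzero_mult_div_cancel_right) (use b in simp)
    have "dist ((l t - c) / t powr \<rho>) (- \<delta> / (1 - b)) < e" if t: "t \<ge> T" for t
    proof -
      from T(2)[OF t] obtain S where S: "(\<lambda>i. l (2 ^ i * t)) \<longlonglongrightarrow> l t + S"
        "\<bar>S / t powr \<rho> - \<delta> / (1 - b)\<bar> \<le> e / 2"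
        unfolding cancel by blast
      have "l t + S = c" using LIMSEQ_unique[OF S(1) same] t T(1) by simp
      then have "(l t - c) = - S" by simp
      then show ?thesis using S(2) e by (simp add: dist_real_def abs_minus_commute)
    qed
    then show "\<forall>\<^sub>F t in at_top. dist ((l t - c) / t powr \<rho>) (- \<delta> / (1 - b)) < e"
      unfolding eventually_at_top_linorder by blast
  qed
  then show ?thesis unfolding b_def by blast
qed

text \<open>The logarithm of \<open>t powr a * p t\<close> makes the ratio condition additive: its
  increments have order \<open>t powr \<rho>\<close>. Exponentiating the resulting expansion gives
  \<open>C = exp L\<close>, so positivity of \<open>C\<close> comes for free.\<close>

lemma second_order_tail_expansion:
  fixes p A :: "real \<Rightarrow> real"
  assumes rho: "\<rho> < 0"
    and p_pos: "eventually (\<lambda>t. p t > 0) at_top"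
    and rate: "((\<lambda>t. t powr (- \<rho>) * A t) \<longlongrightarrow> c) at_top" "c \<noteq> 0"
    and sec: "\<And>x. x > 0 \<Longrightarrow> ((\<lambda>t. (p (t * x) / p t - x powr (- a)) / A t)
        \<longlongrightarrow> x powr (- a) * (x powr \<rho> - 1) / \<rho>) at_top"
  shows "\<exists>C b. C > 0 \<and> ((\<lambda>t. t powr (- \<rho>) * (t powr a * p t - C)) \<longlongrightarrow> b) at_top"
proof -
  define l where "l t = ln (t powr a * p t)" for t
  have r0: "((\<lambda>t::real. t powr \<rho>) \<longlongrightarrow> 0) at_top"
    using tendsto_neg_powr[OF rho filterlim_ident] .
  have rn: "\<forall>\<^sub>F t::real in at_top. t powr \<rho> \<noteq> 0"
    using eventually_gt_at_top[of 0] by eventually_elim simp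
  have An: "\<forall>\<^sub>F t in at_top. A t \<noteq> 0"
    using tendsto_imp_eventually_ne[OF rate] by eventually_elim auto
  have lx: "((\<lambda>t. (l (t * x) - l t) / t powr \<rho>) \<longlongrightarrow> c * (x powr \<rho> - 1) / \<rho>) at_top"
    if x: "x > 0" for x
  proof -
    \<comment> \<open>\<open>y t\<close> is the relative error of the ratio:
      \<open>p (t * x) / p t = x powr (- a) * (1 + y t)\<close>.\<close>
    define y where "y t = x powr a * (p (t * x) / p t - x powr (- a))" for t
    have "((\<lambda>t. x powr a * ((p (t * x) / p t - x powr (- a)) / A t) * (t powr (- \<rho>) * A t))
       \<longlongrightarrow> x powr a * (x powr (- a) * (x powr \<rho> - 1) / \<rho>) * c) at_top"
      by (intro tendsto_intros sec rate x)
    then have "((\<lambda>t. y t / t powr \<rho>)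
       \<longlongrightarrow> x powr a * (x powr (- a) * (x powr \<rho> - 1) / \<rho>) * c) at_top"
      by (rule Lim_transform_eventually)
         (use An in \<open>eventually_elim, simp add: y_def powr_minus_divide\<close>)
    moreover have "x powr a * (x powr (- a) * (x powr \<rho> - 1) / \<rho>) * c = c * (x powr \<rho> - 1) / \<rho>"
      using x by (simp add: powr_minus)
    ultimately have "((\<lambda>t. y t / t powr \<rho>) \<longlongrightarrow> c * (x powr \<rho> - 1) / \<rho>) at_top"
      by (simp only:)
    then have 1: "((\<lambda>t. ln (1 + y t) / t powr \<rho>) \<longlongrightarrow> 1 * (c * (x powr \<rho> - 1) / \<rho>)) at_top"
      by (intro tendsto_deriv_scaled[where \<phi> = "\<lambda>y. ln (1 + y)"] r0 rn)
         (auto intro!: derivative_eq_intros)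
    have "filterlim (\<lambda>t. t * x) at_top at_top"
      using filterlim_tendsto_pos_mult_at_top[OF tendsto_const x filterlim_ident]
      by (simp add: mult.commute)
    then have px: "\<forall>\<^sub>F t in at_top. p (t * x) > 0"
      by (rule eventually_compose_filterlim[OF p_pos])
    from px p_pos eventually_gt_at_top[of 0]
    have "\<forall>\<^sub>F t in at_top. ln (1 + y t) / t powr \<rho> = (l (t * x) - l t) / t powr \<rho>"
    proof eventually_elim
      case (elim t)
      have "1 + y t = x powr a * (p (t * x) / p t)"
        using x by (simp add: y_def powr_minus algebra_simps)
      also have "\<dots> = ((t * x) powr a * p (t * x)) / (t powr a * p t)"
        using elim x by (simp add: powr_mult field_simps)
      also have "ln \<dots> = l (t * x) - l t"
        unfolding l_def using elim x by (subst ln_div) auto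
      finally show ?case by simp
    qed
    from Lim_transform_eventually[OF 1 this] show ?thesis by simp
  qed
  have slow: "((\<lambda>t. l (t * x) - l t) \<longlongrightarrow> 0) at_top" if x: "x > 0" for x
  proof -
    have "((\<lambda>t. (l (t * x) - l t) / t powr \<rho> * t powr \<rho>) \<longlongrightarrow> c * (x powr \<rho> - 1) / \<rho> * 0) at_top"
      by (intro tendsto_mult lx r0 x)
    then have "((\<lambda>t. (l (t * x) - l t) / t powr \<rho> * t powr \<rho>) \<longlongrightarrow> 0) at_top" by simp
    then show ?thesis
      by (rule Lim_transform_eventually) (use rn in \<open>eventually_elim, auto\<close>)
  qed
  \<comment> \<open>The ratio 2 supplies the rate, all other ratios only slow variation. The value
    behind \<open>s\<close> is \<open>c / \<rho>\<close>, since the factor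
    \<open>2 powr \<rho> - 1\<close> cancels.\<close>
  obtain L s where L: "((\<lambda>t. (l t - L) / t powr \<rho>) \<longlongrightarrow> s) at_top"
    using log_tail_expansion[OF rho _ slow, of "c * (2 powr \<rho> - 1) / \<rho>"] lx[of 2]
    by (auto simp: mult.commute[of _ 2])
  have "((\<lambda>t. (exp (l t - L) - 1) / t powr \<rho>) \<longlongrightarrow> 1 * s) at_top"
    by (intro tendsto_deriv_scaled[where \<phi> = "\<lambda>y. exp y - 1"] r0 rn L)
       (auto intro!: derivative_eq_intros)
  then have "((\<lambda>t. exp L * ((exp (l t - L) - 1) / t powr \<rho>)) \<longlongrightarrow> exp L * (1 * s)) at_top"
    by (intro tendsto_intros)
  moreover have "\<forall>\<^sub>F t in at_top. exp L * ((exp (l t - L) - 1) / t powr \<rho>)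
      = t powr (- \<rho>) * (t powr a * p t - exp L)"
    using p_pos eventually_gt_at_top[of 0]
  proof eventually_elim
    case (elim t)
    have "exp L * exp (l t - L) = t powr a * p t"
      using elim by (simp add: exp_diff l_def)
    then show ?case
      using elim by (simp add: powr_minus field_simps)
  qed
  ultimately have "((\<lambda>t. t powr (- \<rho>) * (t powr a * p t - exp L)) \<longlongrightarrow> exp L * (1 * s)) at_top"
    by (rule Lim_transform_eventually)
  then show ?thesis by (intro exI[of _ "exp L"] exI conjI) auto
qed

section \<open>From power tails to quantiles\<close>

lemma filterlim_powr_at_top:
  fixes a :: real
  assumes "a > 0"
  shows "filterlim (\<lambda>t::real. t powr a) at_top at_top"
proof -
  have "filterlim (\<lambda>t::real. exp (a * ln t)) at_top at_top"
    by (intro filterlim_compose[OF exp_at_top] filterlim_tendsto_pos_mult_at_top[OF tendsto_const assms]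
        ln_at_top)
  then show ?thesis
    by (rule filterlim_cong[THEN iffD1, rotated 3, OF _ refl refl])
       (use eventually_gt_at_top[of 0] in \<open>eventually_elim, simp add: powr_def\<close>)
qed

lemma tendsto_of_scaled_tendsto:
  fixes g :: "real \<Rightarrow> real"
  assumes "\<rho> < 0" "((\<lambda>t. t powr (- \<rho>) * (g t - C)) \<longlongrightarrow> b) at_top"
  shows "(g \<longlongrightarrow> C) at_top"
proof -
  have "((\<lambda>t::real. t powr \<rho>) \<longlongrightarrow> 0) at_top"
    using tendsto_neg_powr[OF assms(1) filterlim_ident] .
  then have "((\<lambda>t. C + t powr \<rho> * (t powr (- \<rho>) * (g t - C))) \<longlongrightarrow> C + 0 * b) at_top"
    by (intro tendsto_intros assms)
  then have "((\<lambda>t. C + t powr \<rho> * (t powr (- \<rho>) * (g t - C))) \<longlongrightarrow> C) at_top" by simp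
  then show ?thesis
    by (rule Lim_transform_eventually)
       (use eventually_gt_at_top[of 0] in \<open>eventually_elim, simp add: powr_minus flip: mult.assoc\<close>)
qed

lemma (in prob_space) cdf_rv_eq:
  assumes "Y \<in> borel_measurable M"
  shows "cdf_rv M Y x = 1 - prob {\<omega>\<in>space M. Y \<omega> > x}"
proof -
  have "{\<omega>\<in>space M. Y \<omega> > x} = space M - {\<omega>\<in>space M. Y \<omega> \<le> x}" by auto
  moreover have "{\<omega>\<in>space M. Y \<omega> \<le> x} \<in> events" using assms by measurable
  ultimately show ?thesis unfolding cdf_rv_def by (simp add: prob_compl)
qed

text \<open>At \<open>y * t powr \<gamma>\<close> the tail multiplied by \<open>t\<close> tends to
  \<open>C * y powr (- 1 / \<gamma>)\<close>, which crosses 1 exactly at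
  \<open>y = C powr \<gamma>\<close>. Monotonicity of the tail then traps the infimum between any
  two values of \<open>y\<close> on either side, so the distribution function may have
  jumps.\<close>

lemma (in prob_space) tailq_asymp:
  fixes Y :: "'a \<Rightarrow> real"
  assumes Y: "Y \<in> borel_measurable M" and nn: "\<And>\<omega>. \<omega> \<in> space M \<Longrightarrow> Y \<omega> \<ge> 0"
    and \<gamma>: "\<gamma> > 0" and C: "C > 0"
    and tail: "((\<lambda>x. x powr (1 / \<gamma>) * prob {\<omega>\<in>space M. Y \<omega> > x}) \<longlongrightarrow> C) at_top"
  shows "((\<lambda>t. tailq M Y t / t powr \<gamma>) \<longlongrightarrow> C powr \<gamma>) at_top"
proof -
  define P where "P x = prob {\<omega>\<in>space M. Y \<omega> > x}" for x
  have Pmono: "P y \<le> P x" if "x \<le> y" for x y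
    unfolding P_def by (rule finite_measure_mono) (use that Y in auto)
  have tq: "tailq M Y t = Inf {x. P x \<le> 1 / t}" for t
    unfolding tailq_def cdf_rv_eq[OF Y] P_def by (rule arg_cong[where f = Inf]) auto
  have neg: "P x = 1" if "x < 0" for x
  proof -
    have "{\<omega>\<in>space M. Y \<omega> > x} = space M" using nn that by force
    then show ?thesis unfolding P_def by (simp add: prob_space)
  qed
  \<comment> \<open>For \<open>t > 1\<close> the level \<open>1 / t\<close> is below 1, the value of
    the tail at negative arguments. Hence the set lies in the nonnegative reals and its
    \<open>Inf\<close> is a genuine infimum.\<close>
  have bdd: "bdd_below {x. P x \<le> 1 / t}" if "t > 1" for t
  proof (rule bdd_belowI[of _ 0])
    fix x assume "x \<in> {x. P x \<le> 1 / t}"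
    then show "0 \<le> x" using neg[of x] that by (cases "x < 0") auto
  qed
  have scaled: "((\<lambda>t. t * P (y * t powr \<gamma>)) \<longlongrightarrow> C * y powr (- 1 / \<gamma>)) at_top" if y: "y > 0" for y
  proof -
    have "filterlim (\<lambda>t. y * t powr \<gamma>) at_top at_top"
      by (intro filterlim_tendsto_pos_mult_at_top[OF tendsto_const y] filterlim_powr_at_top \<gamma>)
    from filterlim_compose[OF tail this]
    have "((\<lambda>t. (y * t powr \<gamma>) powr (1 / \<gamma>) * P (y * t powr \<gamma>)) \<longlongrightarrow> C) at_top"
      unfolding P_def .
    then have "((\<lambda>t. y powr (- 1 / \<gamma>) * ((y * t powr \<gamma>) powr (1 / \<gamma>) * P (y * t powr \<gamma>)))
        \<longlongrightarrow> y powr (- 1 / \<gamma>) * C) at_top" by (intro tendsto_intros)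
    then show ?thesis
      by (subst mult.commute[of C], elim Lim_transform_eventually)
         (use eventually_gt_at_top[of 0] in \<open>eventually_elim,
           use y \<gamma> in \<open>simp add: powr_mult powr_powr powr_minus_divide\<close>\<close>)
  qed
  have thr: "y < C powr \<gamma> \<longleftrightarrow> 1 < C * y powr (- 1 / \<gamma>)" "C powr \<gamma> < y \<longleftrightarrow> C * y powr (- 1 / \<gamma>) < 1"
    if y: "y > 0" for y
  proof -
    have mono: "u powr \<gamma> < v powr \<gamma> \<longleftrightarrow> u < v" if "u > 0" "v > 0" for u v :: real
      using that \<gamma> powr_less_mono2[of \<gamma> u v] powr_mono2[of \<gamma> v u] by linarith
    have m: "y powr (1 / \<gamma>) < C \<longleftrightarrow> y < C powr \<gamma>"
      using mono[of "y powr (1 / \<gamma>)" C] y C \<gamma> by (simp add: powr_powr)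
    have m': "C < y powr (1 / \<gamma>) \<longleftrightarrow> C powr \<gamma> < y"
      using mono[of C "y powr (1 / \<gamma>)"] y C \<gamma> by (simp add: powr_powr)
    show "y < C powr \<gamma> \<longleftrightarrow> 1 < C * y powr (- 1 / \<gamma>)" "C powr \<gamma> < y \<longleftrightarrow> C * y powr (- 1 / \<gamma>) < 1"
      using y by (auto simp: m[symmetric] m'[symmetric] powr_minus_divide field_simps)
  qed
  have up: "\<forall>\<^sub>F t in at_top. P (y * t powr \<gamma>) \<le> 1 / t" if "y > C powr \<gamma>" for y
  proof -
    have y: "y > 0" using that C by (smt (verit) powr_gt_zero)
    then have "C * y powr (- 1 / \<gamma>) < 1" using thr that by blast
    from order_tendstoD(2)[OF scaled[OF y] this] eventually_gt_at_top[of 0]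
    show ?thesis by eventually_elim (simp add: field_simps)
  qed
  show ?thesis
  proof (rule order_tendstoI)
    fix z assume z: "z < C powr \<gamma>"
    obtain y where y: "max z 0 < y" "y < C powr \<gamma>"
      using dense[of "max z 0" "C powr \<gamma>"] z C by auto
    have "1 < C * y powr (- 1 / \<gamma>)" using thr y by auto
    from order_tendstoD(1)[OF scaled this] y
    have "\<forall>\<^sub>F t in at_top. 1 < t * P (y * t powr \<gamma>)" by simp
    then show "\<forall>\<^sub>F t in at_top. z < tailq M Y t / t powr \<gamma>"
      using eventually_gt_at_top[of 1] up[of "C powr \<gamma> + 1", simplified]
    proof eventually_elim
      case (elim t)
      \<comment> \<open>\<open>cInf_greatest\<close> also asks for a nonempty set; the instance of
        \<open>up\<close> at \<open>C powr \<gamma> + 1\<close> provides a member.\<close>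
      have "y * t powr \<gamma> \<le> Inf {x. P x \<le> 1 / t}"
      proof (rule cInf_greatest)
        fix x assume "x \<in> {x. P x \<le> 1 / t}"
        then have "t * P x \<le> 1" using elim(2) by (simp add: field_simps)
        then have "t * P x < t * P (y * t powr \<gamma>)" using elim(1) by linarith
        then have "P x < P (y * t powr \<gamma>)" using elim(2) by simp
        then show "y * t powr \<gamma> \<le> x" using Pmono[of x "y * t powr \<gamma>"] by linarith
      qed (use elim(3) in blast)
      then have "y \<le> tailq M Y t / t powr \<gamma>"
        using elim unfolding tq by (simp add: field_simps)
      then show ?case using y by simp
    qed
  next
    fix z assume z: "C powr \<gamma> < z"
    obtain y where y: "C powr \<gamma> < y" "y < z" using dense[OF z] by auto
    show "\<forall>\<^sub>F t in at_top. tailq M Y t / t powr \<gamma> < z"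
      using up[OF y(1)] eventually_gt_at_top[of 1]
    proof eventually_elim
      case (elim t)
      have "tailq M Y t \<le> y * t powr \<gamma>"
        unfolding tq by (rule cInf_lower) (use elim bdd in auto)
      then have "tailq M Y t / t powr \<gamma> \<le> y" using elim by (simp add: field_simps)
      then show ?case using y by simp
    qed
  qed
qed

section \<open>Polar integration over the simplex\<close>

definition orthant_tail :: "real \<Rightarrow> (real^'d) set" where
  "orthant_tail u = {x. (\<forall>j. 0 \<le> x $ j) \<and> u < Rsum x}"

abbreviation (input) angle :: "real^'d \<Rightarrow> real^'d" where
  "angle x \<equiv> (1 / Rsum x) *\<^sub>R x"

lemma Rsum_scaleR: "Rsum (c *\<^sub>R x) = c * Rsum x"
  by (simp add: Rsum_def sum_distrib_left)

lemma continuous_on_Rsum: "continuous_on A (Rsum :: real^'d \<Rightarrow> real)"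
  unfolding Rsum_def by (intro continuous_intros)

lemma borel_measurable_Rsum [measurable]: "(Rsum :: real^'d \<Rightarrow> real) \<in> borel_measurable borel"
  by (intro borel_measurable_continuous_onI continuous_on_Rsum)

lemma borel_measurable_component [measurable]: "(\<lambda>x :: real^'d. x $ j) \<in> borel_measurable borel"
  by (intro borel_measurable_continuous_onI continuous_intros)

lemma borel_measurable_angle [measurable]:
  "(angle :: real^'d \<Rightarrow> real^'d) \<in> borel_measurable borel"
  by measurable

lemma closed_orthant: "closed {x :: real^'d. \<forall>j. 0 \<le> x $ j}"
  by (intro closed_Collect_all closed_Collect_le continuous_intros)

lemma pred_orthant [measurable]: "Measurable.pred borel (\<lambda>x :: real^'d. \<forall>j. 0 \<le> x $ j)"
  using borel_closed[OF closed_orthant] by (simp add: pred_def)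

lemma sets_orthant_tail [measurable]: "orthant_tail u \<in> sets borel"
  unfolding orthant_tail_def by measurable

lemma closed_unit_simplex: "closed (unit_simplex :: (real^'d) set)"
proof -
  have "closed ({x :: real^'d. \<forall>j. 0 \<le> x $ j} \<inter> {x. Rsum x = 1})"
    by (intro closed_Int closed_orthant closed_Collect_eq continuous_on_Rsum continuous_intros)
  then show ?thesis by (simp add: unit_simplex_def Int_def)
qed

lemma sets_unit_simplex [measurable]: "unit_simplex \<in> sets borel"
  using closed_unit_simplex by (rule borel_closed)

lemma angle_in_unit_simplex:
  assumes "\<forall>j. 0 \<le> x $ j" "0 < Rsum x"
  shows "angle x \<in> unit_simplex"
  using assms unfolding unit_simplex_def by (auto simp: Rsum_scaleR)

section \<open>The cone measure on the simplex and volumes of cones and shells\<close>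

lemma sets_simplex_measure [simp, measurable_cong]: "sets simplex_measure = sets borel"
  by (simp add: simplex_measure_def)

lemma space_simplex_measure [simp]: "space simplex_measure = UNIV"
  using sets_eq_imp_space_eq[OF sets_simplex_measure] by simp

text \<open>The condition \<open>0 < Rsum x\<close> removes the apex, where \<open>angle\<close>
  would divide by zero. At \<open>s = 1\<close> this is the set whose volume, times the dimension,
  is the cone measure of \<open>B\<close>.\<close>

definition simplex_cone :: "real \<Rightarrow> (real^'d) set \<Rightarrow> (real^'d) set" where
  "simplex_cone s B = {x. (\<forall>j. 0 \<le> x $ j) \<and> 0 < Rsum x \<and> Rsum x \<le> s \<and> angle x \<in> B}"

lemma sets_simplex_cone [measurable]:
  assumes [measurable]: "B \<in> sets borel"
  shows "simplex_cone s B \<in> sets borel"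
  unfolding simplex_cone_def by measurable

lemma emeasure_simplex_cone_finite: "emeasure lborel (simplex_cone s B :: (real^'d) set) < \<infinity>"
proof (rule emeasure_bounded_finite)
  have "simplex_cone s B \<subseteq> cbox (0 :: real^'d) (\<chi> i. s)"
  proof
    fix x :: "real^'d" assume x: "x \<in> simplex_cone s B"
    have "x $ i \<le> s" for i
    proof -
      have "x $ i \<le> Rsum x" unfolding Rsum_def
        by (rule member_le_sum) (use x in \<open>auto simp: simplex_cone_def\<close>)
      then show ?thesis using x by (auto simp: simplex_cone_def)
    qed
    then show "x \<in> cbox 0 (\<chi> i. s)" using x by (auto simp: simplex_cone_def mem_box_cart)
  qed
  then show "bounded (simplex_cone s B :: (real^'d) set)"
    using bounded_cbox bounded_subset by blast
qed

lemma emeasure_simplex_measure: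
  assumes [measurable]: "(B :: (real^'d) set) \<in> sets borel"
  shows "emeasure simplex_measure B = of_nat CARD('d) * emeasure lborel (simplex_cone 1 B)"
proof -
  let ?D = "{x :: real^'d. (\<forall>j. 0 \<le> x $ j) \<and> 0 < Rsum x \<and> Rsum x \<le> 1}"
  have D: "?D \<in> sets lborel" by measurable
  have "emeasure simplex_measure B = of_nat CARD('d) *
      emeasure (restrict_space lborel ?D) (angle -` B \<inter> space (restrict_space lborel ?D))"
    unfolding simplex_measure_def emeasure_scale_measure
    by (subst emeasure_distr) (auto intro!: measurable_restrict_space1)
  also have "angle -` B \<inter> space (restrict_space lborel ?D) = simplex_cone 1 B"
    by (auto simp: simplex_cone_def space_restrict_space)
  also have "emeasure (restrict_space lborel ?D) (simplex_cone 1 B) = emeasure lborel (simplex_cone 1 B)"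
    by (rule emeasure_restrict_space) (use D in \<open>auto simp: simplex_cone_def\<close>)
  finally show ?thesis .
qed

lemma finite_measure_simplex: "finite_measure (simplex_measure :: (real^'d) measure)"
proof
  have "emeasure (simplex_measure :: (real^'d) measure) UNIV < \<infinity>"
    by (subst emeasure_simplex_measure)
       (use emeasure_simplex_cone_finite[of 1 "UNIV :: (real^'d) set"] in
         \<open>auto simp: ennreal_mult_less_top ennreal_of_nat_eq_real_of_nat\<close>)
  then show "emeasure (simplex_measure :: (real^'d) measure) (space simplex_measure) \<noteq> \<infinity>" by simp
qed

text \<open>The cone measure is a measure on the whole space, while the angular density is
  controlled only on the simplex. This fact allows integrands to be changed elsewhere.\<close>

lemma AE_simplex_measure: "AE w in simplex_measure. w \<in> (unit_simplex :: (real^'d) set)"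
proof (rule AE_I)
  have "simplex_cone 1 (- unit_simplex :: (real^'d) set) = {}"
    using angle_in_unit_simplex unfolding simplex_cone_def by blast
  then show "emeasure simplex_measure (- unit_simplex :: (real^'d) set) = 0"
    by (subst emeasure_simplex_measure) auto
qed auto

text \<open>This is what later makes the mean of \<open>w $ j\<close> under the angular measure
  strictly positive. The open box with sides \<open>1 / d\<close> lies in the cone, because its
  coordinates are positive and sum to at most 1, and a nonempty open set is not negligible.\<close>

lemma emeasure_simplex_coordinate_pos: "emeasure simplex_measure {w :: real^'d. 0 < w $ j} \<noteq> 0"
proof
  let ?B = "{w :: real^'d. 0 < w $ j}"
  let ?O = "box (0 :: real^'d) (\<chi> i. 1 / real CARD('d))"
  have [measurable]: "?B \<in> sets borel"
    by (intro borel_open open_Collect_less continuous_intros)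
  assume "emeasure simplex_measure ?B = 0"
  then have "simplex_cone 1 ?B \<in> null_sets lborel"
    by (simp add: emeasure_simplex_measure null_sets_def)
  moreover have "?O \<subseteq> simplex_cone 1 ?B"
  proof
    fix x assume "x \<in> ?O"
    then have x: "0 < x $ i" "x $ i < 1 / real CARD('d)" for i by (auto simp: mem_box_cart)
    have pos: "0 < Rsum x" unfolding Rsum_def by (intro sum_pos) (use x in auto)
    have "Rsum x \<le> (\<Sum>i\<in>(UNIV :: 'd set). 1 / real CARD('d))"
      unfolding Rsum_def by (intro sum_mono less_imp_le x)
    then show "x \<in> simplex_cone 1 ?B"
      using x pos by (auto simp: simplex_cone_def less_imp_le)
  qed
  ultimately have "?O \<in> null_sets lborel" by (auto intro: null_sets_subset)
  then have "negligible ?O"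
    unfolding negligible_iff_null_sets by (rule null_sets_completionI)
  moreover have "(\<chi> i. 1 / (2 * real CARD('d))) \<in> ?O" by (simp add: mem_box_cart field_simps)
  ultimately show False using open_not_negligible[OF open_box] by blast
qed

text \<open>Dilation by \<open>s\<close> maps the cone of height 1 onto the cone of height
  \<open>s\<close> and multiplies Lebesgue measure by the \<open>d\<close>-th power of
  \<open>s\<close>. The dimension stays as a factor on the left to avoid division in
  \<open>ennreal\<close>.\<close>

lemma emeasure_simplex_cone:
  assumes s: "s > 0" and [measurable]: "(B :: (real^'d) set) \<in> sets borel"
  shows "of_nat CARD('d) * emeasure lborel (simplex_cone s B)
    = ennreal (s ^ CARD('d)) * emeasure simplex_measure B"
proof -
  have "emeasure lborel (simplex_cone s B) = emeasure (density (distr lborel borel (\<lambda>x::real^'d. 0 + s *\<^sub>R x))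
      (\<lambda>_. \<bar>s\<bar> ^ DIM(real^'d))) (simplex_cone s B)"
    using s by (subst lborel_affine[of s "0 :: real^'d"]) auto
  also have "\<dots> = ennreal (s ^ CARD('d)) * emeasure lborel ((\<lambda>x. s *\<^sub>R x) -` simplex_cone s B)"
    using s by (subst emeasure_density_const) (auto simp: emeasure_distr)
  also have "(\<lambda>x. s *\<^sub>R x) -` simplex_cone s B = simplex_cone 1 B"
    using s by (auto simp: simplex_cone_def Rsum_scaleR zero_le_mult_iff zero_less_mult_iff)
  finally show ?thesis
    by (simp add: emeasure_simplex_measure mult_ac)
qed

text \<open>Truncated subtraction in \<open>ennreal\<close> is harmless here because the inner cone
  has finite volume and the cone measure is finite.\<close>

lemma emeasure_simplex_shell:
  assumes u: "0 < u" "u \<le> s" and B [measurable]: "(B :: (real^'d) set) \<in> sets borel"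
  shows "of_nat CARD('d) * emeasure lborel (simplex_cone s B - simplex_cone u B)
    = ennreal (s ^ CARD('d) - u ^ CARD('d)) * emeasure simplex_measure B"
proof -
  interpret finite_measure "simplex_measure :: (real^'d) measure" by (rule finite_measure_simplex)
  have "emeasure lborel (simplex_cone s B - simplex_cone u B)
      = emeasure lborel (simplex_cone s B) - emeasure lborel (simplex_cone u B)"
    by (rule emeasure_Diff)
       (use u emeasure_simplex_cone_finite[of u B] in \<open>auto simp: simplex_cone_def\<close>)
  then have "of_nat CARD('d) * emeasure lborel (simplex_cone s B - simplex_cone u B)
      = of_nat CARD('d) * emeasure lborel (simplex_cone s B) - of_nat CARD('d) * emeasure lborel (simplex_cone u B)"
    by (simp add: ennreal_right_diff_distrib)
  also have "\<dots> = ennreal (s ^ CARD('d)) * emeasure simplex_measure B - ennreal (u ^ CARD('d)) * emeasure simplex_measure B"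
    using u by (simp add: emeasure_simplex_cone)
  also have "\<dots> = ennreal (s ^ CARD('d) - u ^ CARD('d)) * emeasure simplex_measure B"
    using u by (simp add: emeasure_eq_measure left_diff_distrib ennreal_minus flip: ennreal_mult')
  finally show ?thesis .
qed

text \<open>Writing \<open>r powr (- n - \<alpha>)\<close> as an integral over \<open>s \<ge> r\<close> reduces the claim to the
  volumes of the shells \<open>u < Rsum x \<le> s\<close>.\<close>
lemma nn_integral_radial:
  fixes B :: "(real^'d) set"
  defines "n \<equiv> real CARD('d)"
  assumes u: "u > 0" and \<alpha>: "\<alpha> > 0" and [measurable]: "B \<in> sets borel"
  shows "(\<integral>\<^sup>+x. ennreal (indicator (orthant_tail u) x * Rsum x powr (- n - \<alpha>)) * indicator B (angle x) \<partial>lborel)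
    = ennreal (u powr (- \<alpha>) / \<alpha>) * emeasure simplex_measure B"
proof -
  have n: "n > 0" unfolding n_def by simp
  define c where "c s = (n + \<alpha>) * s powr (- n - \<alpha> - 1)" for s :: real
  have [measurable]: "c \<in> borel_measurable borel" unfolding c_def by measurable
  have c_nn: "c s \<ge> 0" for s using n \<alpha> unfolding c_def by simp
  have layer: "ennreal (r powr (- n - \<alpha>)) = (\<integral>\<^sup>+s. ennreal (c s) * indicator {r..} s \<partial>lborel)"
    if r: "r > 0" for r
  proof -
    have "(\<integral>\<^sup>+s. ennreal (c s) * indicator {r..} s \<partial>lborel) = ennreal (0 - (- (r powr (- n - \<alpha>))))"
    proof (rule nn_integral_FTC_atLeast)
      show "((\<lambda>s. - (s powr (- n - \<alpha>))) has_real_derivative c x) (at x)" if "r \<le> x" for x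
        unfolding c_def using r that by (auto intro!: derivative_eq_intros simp: algebra_simps)
      have "((\<lambda>s::real. s powr (- n - \<alpha>)) \<longlongrightarrow> 0) at_top"
        using n \<alpha> by (intro tendsto_neg_powr filterlim_ident) auto
      from tendsto_minus[OF this] show "((\<lambda>s::real. - (s powr (- n - \<alpha>))) \<longlongrightarrow> 0) at_top" by simp
    qed (use c_nn in auto)
    then show ?thesis by simp
  qed
  define Q where "Q = {(s, x :: real^'d). x \<in> orthant_tail u \<and> Rsum x \<le> s \<and> angle x \<in> B}"
  have "(\<integral>\<^sup>+x. ennreal (indicator (orthant_tail u) x * Rsum x powr (- n - \<alpha>)) * indicator B (angle x) \<partial>lborel)
      = (\<integral>\<^sup>+x. (\<integral>\<^sup>+s. ennreal (c s) * indicator Q (s, x) \<partial>lborel) \<partial>lborel)"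
  proof (rule nn_integral_cong)
    fix x :: "real^'d"
    show "ennreal (indicator (orthant_tail u) x * Rsum x powr (- n - \<alpha>)) * indicator B (angle x)
      = (\<integral>\<^sup>+s. ennreal (c s) * indicator Q (s, x) \<partial>lborel)"
    proof (cases "x \<in> orthant_tail u \<and> angle x \<in> B")
      case True
      then have "Rsum x > 0" using u by (auto simp: orthant_tail_def)
      moreover have "indicator Q (s, x) = (indicator {Rsum x..} s :: ennreal)" for s
        using True by (auto simp: Q_def indicator_def)
      ultimately show ?thesis using True layer by simp
    qed (auto simp: Q_def)
  qed
  also have "\<dots> = (\<integral>\<^sup>+s. (\<integral>\<^sup>+x. ennreal (c s) * indicator Q (s, x) \<partial>lborel) \<partial>lborel)"
    unfolding Q_def by (rule lborel_pair.Fubini') measurable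
  also have "\<dots> = (\<integral>\<^sup>+s. ennreal (c s * (s ^ CARD('d) - u ^ CARD('d)) / n) * indicator {u..} s
      * emeasure simplex_measure B \<partial>lborel)"
  proof (rule nn_integral_cong)
    fix s :: real
    have "(\<integral>\<^sup>+x. ennreal (c s) * indicator Q (s, x) \<partial>lborel)
        = (\<integral>\<^sup>+x. ennreal (c s) * indicator (simplex_cone s B - simplex_cone u B) x \<partial>lborel)"
      using u by (intro nn_integral_cong arg_cong2[where f = "(*)"])
        (auto simp: Q_def orthant_tail_def simplex_cone_def indicator_def)
    also have "\<dots> = ennreal (c s) * emeasure lborel (simplex_cone s B - simplex_cone u B)"
      by (simp add: nn_integral_cmult_indicator)
    also have "\<dots> = ennreal (c s * (s ^ CARD('d) - u ^ CARD('d)) / n) * indicator {u..} s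
      * emeasure simplex_measure B"
    proof (cases "u \<le> s")
      case True
      have inv: "ennreal (1 / n) * of_nat CARD('d) = 1"
        unfolding n_def by (simp add: ennreal_of_nat_eq_real_of_nat flip: ennreal_mult)
      have pow: "u ^ CARD('d) \<le> s ^ CARD('d)" using u True by (intro power_mono) auto
      have "ennreal (c s) * emeasure lborel (simplex_cone s B - simplex_cone u B)
        = ennreal (c s) * (ennreal (1 / n) * of_nat CARD('d)) * emeasure lborel (simplex_cone s B - simplex_cone u B)"
        by (simp add: inv)
      also have "\<dots> = ennreal (c s) * ennreal (1 / n) *
          (ennreal (s ^ CARD('d) - u ^ CARD('d)) * emeasure simplex_measure B)"
        by (subst emeasure_simplex_shell[symmetric]) (use u True in \<open>auto simp: mult_ac\<close>)
      also have "\<dots> = ennreal (c s * (1 / n) * (s ^ CARD('d) - u ^ CARD('d))) * emeasure simplex_measure B"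
        using c_nn[of s] n pow
          ennreal_mult[of "c s * (1 / n)" "s ^ CARD('d) - u ^ CARD('d)"] ennreal_mult[of "c s" "1 / n"]
        by (simp add: mult.assoc)
      finally show ?thesis using True by (simp add: mult_ac)
    next
      case False
      then have "simplex_cone s B - simplex_cone u B = {}" by (auto simp: simplex_cone_def)
      then show ?thesis using False by (simp only:) simp
    qed
    finally show "(\<integral>\<^sup>+x. ennreal (c s) * indicator Q (s, x) \<partial>lborel) = \<dots>" .
  qed
  also have "\<dots> = (\<integral>\<^sup>+s. ennreal (c s * (s ^ CARD('d) - u ^ CARD('d)) / n) * indicator {u..} s \<partial>lborel)
      * emeasure simplex_measure B"
    by (rule nn_integral_multc) measurable
  \<comment> \<open>The antiderivative is normalised to vanish at infinity, so the integral is 0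
    minus its value at \<open>u\<close>.\<close>
  also have "(\<integral>\<^sup>+s. ennreal (c s * (s ^ CARD('d) - u ^ CARD('d)) / n) * indicator {u..} s \<partial>lborel)
      = ennreal (0 - (n + \<alpha>) / n * (u powr n * u powr (- n - \<alpha>) / (n + \<alpha>) - u powr (- \<alpha>) / \<alpha>))"
  proof (rule nn_integral_FTC_atLeast[where T = 0
      and F = "\<lambda>s. (n + \<alpha>) / n * (u powr n * s powr (- n - \<alpha>) / (n + \<alpha>) - s powr (- \<alpha>) / \<alpha>)"])
    show "((\<lambda>s. (n + \<alpha>) / n * (u powr n * s powr (- n - \<alpha>) / (n + \<alpha>) - s powr (- \<alpha>) / \<alpha>)) \<longlongrightarrow> 0) at_top"
    proof -
      have 1: "((\<lambda>s::real. s powr (- n - \<alpha>)) \<longlongrightarrow> 0) at_top" "((\<lambda>s::real. s powr (- \<alpha>)) \<longlongrightarrow> 0) at_top"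
        using n \<alpha> by (intro tendsto_neg_powr filterlim_ident; simp)+
      have "((\<lambda>s. (n + \<alpha>) / n * (u powr n * s powr (- n - \<alpha>) / (n + \<alpha>) - s powr (- \<alpha>) / \<alpha>))
          \<longlongrightarrow> (n + \<alpha>) / n * (u powr n * 0 / (n + \<alpha>) - 0 / \<alpha>)) at_top"
        by (intro tendsto_intros 1) (use n \<alpha> in auto)
      then show ?thesis by simp
    qed
    fix s assume s: "u \<le> s"
    have "u ^ CARD('d) \<le> s ^ CARD('d)" using u s by (intro power_mono) auto
    then show "0 \<le> c s * (s ^ CARD('d) - u ^ CARD('d)) / n" using c_nn n by simp
    have pw: "u ^ CARD('d) = u powr n" "s ^ CARD('d) = s powr n"
      using u s unfolding n_def by (auto simp: powr_realpow)
    have e: "s powr (- \<alpha> - 1) = s powr (- n - \<alpha> - 1) * s powr n"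
      by (simp add: powr_add[symmetric])
    have "((\<lambda>s. (n + \<alpha>) / n * (u powr n * s powr (- n - \<alpha>) / (n + \<alpha>) - s powr (- \<alpha>) / \<alpha>))
      has_real_derivative (n + \<alpha>) / n * (u powr n * ((- n - \<alpha>) * s powr (- n - \<alpha> - 1)) / (n + \<alpha>)
        - (- \<alpha>) * s powr (- \<alpha> - 1) / \<alpha>)) (at s)"
      using u s n \<alpha> by (auto intro!: derivative_eq_intros)
    also have "(n + \<alpha>) / n * (u powr n * ((- n - \<alpha>) * s powr (- n - \<alpha> - 1)) / (n + \<alpha>)
        - (- \<alpha>) * s powr (- \<alpha> - 1) / \<alpha>) = (n + \<alpha>) / n * (s powr (- \<alpha> - 1) - u powr n * s powr (- n - \<alpha> - 1))"
    proof -
      have "(- n - \<alpha>) / (n + \<alpha>) = - 1" "(- \<alpha>) / \<alpha> = - 1"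
        using n \<alpha> by (auto simp: field_simps)
      then have "u powr n * ((- n - \<alpha>) * s powr (- n - \<alpha> - 1)) / (n + \<alpha>) = u powr n * (-1 * s powr (- n - \<alpha> - 1))"
        "(- \<alpha>) * s powr (- \<alpha> - 1) / \<alpha> = - 1 * s powr (- \<alpha> - 1)"
        by (metis times_divide_eq_left times_divide_eq_right)+
      then show ?thesis by (simp only:) simp
    qed
    also have "\<dots> = c s * (s ^ CARD('d) - u ^ CARD('d)) / n"
      unfolding c_def pw e by (simp add: left_diff_distrib right_diff_distrib diff_divide_distrib mult_ac)
    finally show "((\<lambda>s. (n + \<alpha>) / n * (u powr n * s powr (- n - \<alpha>) / (n + \<alpha>) - s powr (- \<alpha>) / \<alpha>))
      has_real_derivative c s * (s ^ CARD('d) - u ^ CARD('d)) / n) (at s)" .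
  qed measurable
  also have "0 - (n + \<alpha>) / n * (u powr n * u powr (- n - \<alpha>) / (n + \<alpha>) - u powr (- \<alpha>) / \<alpha>)
      = u powr (- \<alpha>) / \<alpha>"
  proof -
    have "u powr n * u powr (- n - \<alpha>) = u powr (- \<alpha>)"
      by (simp add: powr_add[symmetric])
    moreover have "0 - (n + \<alpha>) / n * (z / (n + \<alpha>) - z / \<alpha>) = z / \<alpha>" for z
      using n \<alpha> by (simp add: divide_simps) (simp add: algebra_simps)
    ultimately show ?thesis by (simp only:)
  qed
  finally show ?thesis .
qed

text \<open>\<open>nn_integral_radial\<close>, read for all Borel \<open>B\<close>, says that the
  radial density on the tail region is pushed forward by \<open>angle\<close> to a constant multiple
  of the cone measure. Change of variables then covers signed \<open>k\<close>; since the cone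
  measure is finite and lives on the simplex, boundedness there gives integrability.\<close>

lemma has_integral_radial:
  fixes k :: "real^'d \<Rightarrow> real"
  defines "n \<equiv> real CARD('d)"
  assumes u: "u > 0" and \<alpha>: "\<alpha> > 0" and [measurable]: "k \<in> borel_measurable borel"
    and k: "bounded (k ` unit_simplex)"
  shows "has_bochner_integral lborel
    (\<lambda>x. indicator (orthant_tail u) x * (Rsum x powr (- n - \<alpha>) * k (angle x)))
    (u powr (- \<alpha>) / \<alpha> * (\<integral>w. k w \<partial>simplex_measure))"
proof -
  interpret finite_measure "simplex_measure :: (real^'d) measure" by (rule finite_measure_simplex)
  define d where "d x = indicator (orthant_tail u) x * Rsum x powr (- n - \<alpha>)" for x :: "real^'d"
  have [measurable]: "d \<in> borel_measurable borel" unfolding d_def by measurable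
  define c where "c = u powr (- \<alpha>) / \<alpha>"
  have c: "c \<ge> 0" using \<alpha> unfolding c_def by simp
  have meas: "distr (density lborel (\<lambda>x. ennreal (d x))) borel angle = density simplex_measure (\<lambda>_. ennreal c)"
  proof (rule measure_eqI)
    fix B :: "(real^'d) set" assume "B \<in> sets (distr (density lborel (\<lambda>x. ennreal (d x))) borel angle)"
    then have [measurable]: "B \<in> sets borel" by simp
    have "emeasure (distr (density lborel (\<lambda>x. ennreal (d x))) borel angle) B
        = emeasure (density lborel (\<lambda>x. ennreal (d x))) (angle -` B)"
      by (subst emeasure_distr) auto
    also have "\<dots> = (\<integral>\<^sup>+x. ennreal (d x) * indicator (angle -` B) x \<partial>lborel)"
      by (rule emeasure_density) (use measurable_sets[OF borel_measurable_angle, of B] in auto)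
    also have "\<dots> = (\<integral>\<^sup>+x. ennreal (d x) * indicator B (angle x) \<partial>lborel)"
      by (intro nn_integral_cong) (auto simp: indicator_def)
    also have "\<dots> = ennreal c * emeasure simplex_measure B"
      unfolding d_def c_def n_def by (rule nn_integral_radial) (use u \<alpha> in auto)
    finally show "emeasure (distr (density lborel (\<lambda>x. ennreal (d x))) borel angle) B
      = emeasure (density simplex_measure (\<lambda>_. ennreal c)) B"
      by (simp add: emeasure_density_const)
  qed simp
  from k obtain K where K: "\<And>w. w \<in> unit_simplex \<Longrightarrow> \<bar>k w\<bar> \<le> K"
    unfolding bounded_iff by auto
  have "integrable simplex_measure k"
    by (rule integrable_const_bound[of _ K]) (use AE_simplex_measure K in \<open>auto elim: eventually_mono\<close>)
  then have "integrable (density simplex_measure (\<lambda>_. ennreal c)) k"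
    using c by (subst integrable_density) auto
  then have "integrable (density lborel (\<lambda>x. ennreal (d x))) (\<lambda>x. k (angle x))"
    unfolding meas[symmetric] by (subst (asm) integrable_distr_eq) auto
  then have "integrable lborel (\<lambda>x. d x *\<^sub>R k (angle x))"
    by (subst (asm) integrable_density) (auto simp: d_def)
  moreover have "(\<integral>x. d x *\<^sub>R k (angle x) \<partial>lborel) = c * (\<integral>w. k w \<partial>simplex_measure)"
  proof -
    have "(\<integral>x. d x *\<^sub>R k (angle x) \<partial>lborel) = (\<integral>x. k (angle x) \<partial>density lborel (\<lambda>x. ennreal (d x)))"
      by (subst integral_density) (auto simp: d_def)
    also have "\<dots> = (\<integral>w. k w \<partial>distr (density lborel (\<lambda>x. ennreal (d x))) borel angle)"
      by (subst integral_distr) auto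
    also have "\<dots> = c * (\<integral>w. k w \<partial>simplex_measure)"
      unfolding meas using c by (subst integral_density) auto
    finally show ?thesis .
  qed
  ultimately show ?thesis
    unfolding has_bochner_integral_iff d_def c_def by (simp add: mult.assoc)
qed

text \<open>On the tail region, \<phi> splits into \<open>H\<close>, homogeneous of degree
  \<open>- n - a\<close>, a correction \<open>G\<close> of degree \<open>- n - \<beta>\<close> with
  \<open>\<beta> = a - \<rho>\<close>, and a remainder at most a small multiple of the radial
  function of degree \<open>- n - \<beta>\<close>. The first two integrate exactly by
  \<open>has_integral_radial\<close>, and \<open>b\<close> is the cone integral of \<open>g\<close>
  divided by \<beta>.\<close>

lemma tail_integral_expansion:
  fixes \<phi> h g :: "real^'d \<Rightarrow> real"
  assumes a: "a > 0" and rho: "\<rho> < 0"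
    and [measurable]: "\<phi> \<in> borel_measurable borel" "h \<in> borel_measurable borel"
    and bdd: "bounded (h ` unit_simplex)" "bounded (g ` unit_simplex)"
    and lim: "uniform_limit unit_simplex
      (\<lambda>t w. t powr (- \<rho>) * (t powr (real CARD('d) + a) * \<phi> (t *\<^sub>R w) - h w)) g at_top"
  shows "\<exists>b. ((\<lambda>u. u powr (- \<rho>) * (u powr a * (\<integral>x. indicator (orthant_tail u) x * \<phi> x \<partial>lborel)
    - (\<integral>w. h w \<partial>simplex_measure) / a)) \<longlongrightarrow> b) at_top"
proof -
  interpret finite_measure "simplex_measure :: (real^'d) measure" by (rule finite_measure_simplex)
  define n where "n = real CARD('d)"
  define \<beta> where "\<beta> = a - \<rho>"
  have \<beta>: "\<beta> > 0" using a rho unfolding \<beta>_def by simp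
  \<comment> \<open>Measurability of \<open>g\<close> is not given. Cut off to the simplex, it is a
    pointwise limit of measurable functions along integer \<open>t\<close>.\<close>
  define g' where "g' w = indicator unit_simplex w * g w" for w :: "real^'d"
  have [measurable]: "g' \<in> borel_measurable borel"
  proof (rule borel_measurable_LIMSEQ_real)
    fix w :: "real^'d"
    show "(\<lambda>i. indicator unit_simplex w * (real i powr (- \<rho>) *
        (real i powr (real CARD('d) + a) * \<phi> (real i *\<^sub>R w) - h w))) \<longlonglongrightarrow> g' w"
    proof (cases "w \<in> unit_simplex")
      case True
      from filterlim_compose[OF tendsto_uniform_limitI[OF lim True] filterlim_real_sequentially]
      show ?thesis using True by (simp add: g'_def)
    qed (simp add: g'_def)
  qed measurable
  have bdd': "bounded (g' ` unit_simplex)"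
    using bdd(2) by (simp add: g'_def cong: image_cong)
  define b where "b = (\<integral>w. g' w \<partial>simplex_measure) / \<beta>"
  define V where "V = measure simplex_measure (UNIV :: (real^'d) set)"
  have V: "V \<ge> 0" unfolding V_def by simp
  have "((\<lambda>u. u powr (- \<rho>) * (u powr a * (\<integral>x. indicator (orthant_tail u) x * \<phi> x \<partial>lborel)
    - (\<integral>w. h w \<partial>simplex_measure) / a)) \<longlongrightarrow> b) at_top"
  proof (rule tendstoI)
    fix e :: real assume e: "e > 0"
    \<comment> \<open>Chosen so that the final error \<open>V * e' / \<beta>\<close> equals
      \<open>e * (V / (V + 1))\<close>, which is below \<open>e\<close> even if
      \<open>V = 0\<close>.\<close>
    define e' where "e' = e * \<beta> / (V + 1)"
    have e': "e' > 0" using e \<beta> V unfolding e'_def by simp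
    from uniform_limitD[OF lim e'] obtain T where
      T: "\<And>t w. t \<ge> T \<Longrightarrow> w \<in> unit_simplex \<Longrightarrow>
        dist (t powr (- \<rho>) * (t powr (real CARD('d) + a) * \<phi> (t *\<^sub>R w) - h w)) (g w) < e'"
      unfolding eventually_at_top_linorder by blast
    have "dist (u powr (- \<rho>) * (u powr a * (\<integral>x. indicator (orthant_tail u) x * \<phi> x \<partial>lborel)
      - (\<integral>w. h w \<partial>simplex_measure) / a)) b < e" if u: "u \<ge> max T 1" for u
    proof -
      have u0: "u > 0" using u by simp
      define I where "I x = (indicator (orthant_tail u) x :: real)" for x :: "real^'d"
      have [measurable]: "I \<in> borel_measurable borel" unfolding I_def by measurable
      define H where "H x = I x * (Rsum x powr (- n - a) * h (angle x))" for x
      define G where "G x = I x * (Rsum x powr (- n - \<beta>) * g' (angle x))" for x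
      define E where "E x = I x * (Rsum x powr (- n - \<beta>) * e')" for x :: "real^'d"
      define \<psi> where "\<psi> x = I x * \<phi> x - H x - G x" for x
      have [measurable]: "H \<in> borel_measurable borel" "G \<in> borel_measurable borel"
        unfolding H_def G_def by measurable
      have [measurable]: "\<psi> \<in> borel_measurable borel"
        unfolding \<psi>_def by measurable
      have hH: "has_bochner_integral lborel H (u powr (- a) / a * (\<integral>w. h w \<partial>simplex_measure))"
        unfolding H_def I_def n_def by (intro has_integral_radial u0 a bdd) measurable
      have hG: "has_bochner_integral lborel G (u powr (- \<beta>) / \<beta> * (\<integral>w. g' w \<partial>simplex_measure))"
        unfolding G_def I_def n_def by (intro has_integral_radial u0 \<beta> bdd') measurable
      have hE: "has_bochner_integral lborel E (u powr (- \<beta>) / \<beta> * (\<integral>w. e' \<partial>(simplex_measure :: (real^'d) measure)))"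
        unfolding E_def I_def n_def by (rule has_integral_radial) (use u0 \<beta> in \<open>auto simp: bounded_iff\<close>)
      have le: "\<bar>\<psi> x\<bar> \<le> E x" for x
      proof (cases "x \<in> orthant_tail u")
        case True
        define r where "r = Rsum x"
        define w where "w = angle x"
        have r: "r > u" using True by (simp add: orthant_tail_def r_def)
        have w: "w \<in> unit_simplex" unfolding w_def
          using True u0 by (intro angle_in_unit_simplex) (auto simp: orthant_tail_def)
        have x: "x = r *\<^sub>R w" using r u0 by (simp add: w_def r_def)
        \<comment> \<open>The uniform bound is applied with \<open>t\<close> equal to the radius of
          \<open>x\<close> itself, which exceeds \<open>T\<close>. Multiplying by
          \<open>r powr (- n - \<beta>)\<close> turns the scaled error into \<open>\<psi> x\<close>,
          because the exponents in front of \<open>\<phi> x\<close> add up to 0.\<close>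
        have "\<bar>r powr (- \<rho>) * (r powr (n + a) * \<phi> x - h w) - g w\<bar> \<le> e'"
          using T[OF _ w, of r] r u unfolding x n_def dist_real_def by simp
        then have "r powr (- n - \<beta>) * \<bar>r powr (- \<rho>) * (r powr (n + a) * \<phi> x - h w) - g w\<bar>
          \<le> r powr (- n - \<beta>) * e'"
          by (intro mult_left_mono) auto
        also have "r powr (- n - \<beta>) * \<bar>r powr (- \<rho>) * (r powr (n + a) * \<phi> x - h w) - g w\<bar>
          = \<bar>r powr (- n - \<beta>) * (r powr (- \<rho>) * (r powr (n + a) * \<phi> x - h w) - g w)\<bar>"
          by (simp add: abs_mult)
        also have "r powr (- n - \<beta>) * (r powr (- \<rho>) * (r powr (n + a) * \<phi> x - h w) - g w)
          = (r powr (- n - \<beta>) * r powr (- \<rho>) * r powr (n + a)) * \<phi> x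
            - (r powr (- n - \<beta>) * r powr (- \<rho>)) * h w - r powr (- n - \<beta>) * g w"
          by (simp add: algebra_simps)
        also have "r powr (- n - \<beta>) * r powr (- \<rho>) * r powr (n + a) = 1"
          using r u0 by (simp add: powr_add[symmetric] \<beta>_def)
        also have "r powr (- n - \<beta>) * r powr (- \<rho>) = r powr (- n - a)"
          by (simp add: powr_add[symmetric] \<beta>_def)
        finally show ?thesis
          using True w w_def by (simp add: \<psi>_def H_def G_def E_def I_def g'_def flip: r_def)
      qed (simp add: \<psi>_def H_def G_def E_def I_def)
      \<comment> \<open>Domination by \<open>E\<close> makes \<psi> integrable, hence also \<phi> on
        the tail region, being the sum of \<open>H\<close>, \<open>G\<close> and \<psi>
        there.\<close>
      have i\<psi>: "integrable lborel \<psi>"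
        by (rule Bochner_Integration.integrable_bound[of _ E])
           (use hE le in \<open>auto simp: has_bochner_integral_iff intro: order_trans[OF _ abs_ge_self]\<close>)
      have "\<bar>\<integral>x. \<psi> x \<partial>lborel\<bar> \<le> (\<integral>x. E x \<partial>lborel)"
        using Bochner_Integration.integral_norm_bound_integral[OF i\<psi>, of E] hE le by (simp add: has_bochner_integral_iff)
      also have "\<dots> = u powr (- \<beta>) / \<beta> * (V * e')"
        using hE by (simp add: has_bochner_integral_iff V_def)
      finally have \<psi>le: "\<bar>\<integral>x. \<psi> x \<partial>lborel\<bar> \<le> u powr (- \<beta>) / \<beta> * (V * e')" .
      have "(\<integral>x. I x * \<phi> x \<partial>lborel) = (\<integral>x. H x + G x + \<psi> x \<partial>lborel)"
        by (simp add: \<psi>_def)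
      also have "\<dots> = (\<integral>x. H x \<partial>lborel) + (\<integral>x. G x \<partial>lborel) + (\<integral>x. \<psi> x \<partial>lborel)"
        using hH hG i\<psi> by (simp add: has_bochner_integral_iff)
      also have "\<dots> = u powr (- a) / a * (\<integral>w. h w \<partial>simplex_measure) + u powr (- \<beta>) * b + (\<integral>x. \<psi> x \<partial>lborel)"
        using hH hG by (simp add: has_bochner_integral_iff b_def)
      finally have eq: "(\<integral>x. I x * \<phi> x \<partial>lborel) = \<dots>" .
      have p: "u powr a * u powr (- a) = 1" "u powr (- \<rho>) * u powr a = u powr \<beta>" "u powr \<beta> * u powr (- \<beta>) = 1"
        using u0 by (simp_all add: powr_add[symmetric] \<beta>_def)
      have "u powr (- \<rho>) * (u powr a * (\<integral>x. I x * \<phi> x \<partial>lborel) - (\<integral>w. h w \<partial>simplex_measure) / a)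
        = u powr (- \<rho>) * ((u powr a * u powr (- a)) * ((\<integral>w. h w \<partial>simplex_measure) / a) - (\<integral>w. h w \<partial>simplex_measure) / a)
          + (u powr (- \<rho>) * u powr a) * u powr (- \<beta>) * b + (u powr (- \<rho>) * u powr a) * (\<integral>x. \<psi> x \<partial>lborel)"
        unfolding eq by (simp add: algebra_simps)
      also have "\<dots> = b + u powr \<beta> * (\<integral>x. \<psi> x \<partial>lborel)"
        unfolding p by simp
      finally have "\<bar>u powr (- \<rho>) * (u powr a * (\<integral>x. I x * \<phi> x \<partial>lborel) - (\<integral>w. h w \<partial>simplex_measure) / a) - b\<bar>
        = u powr \<beta> * \<bar>\<integral>x. \<psi> x \<partial>lborel\<bar>"
        by (simp add: abs_mult)
      also have "\<dots> \<le> u powr \<beta> * (u powr (- \<beta>) / \<beta> * (V * e'))"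
        using \<psi>le by (intro mult_left_mono) auto
      also have "\<dots> = V * e' / \<beta>"
        using p(3) by (simp flip: mult.assoc)
      also have "\<dots> = e * (V / (V + 1))"
        using \<beta> by (simp add: e'_def)
      also have "\<dots> < e * 1"
        using e V by (intro mult_strict_left_mono) auto
      finally show ?thesis by (simp add: dist_real_def I_def)
    qed
    then show "\<forall>\<^sub>F u in at_top. dist (u powr (- \<rho>) * (u powr a *
        (\<integral>x. indicator (orthant_tail u) x * \<phi> x \<partial>lborel) - (\<integral>w. h w \<partial>simplex_measure) / a)) b < e"
      unfolding eventually_at_top_linorder by blast
  qed
  then show ?thesis by blast
qed

section \<open>The expected shortfall contribution\<close>

lemma uniform_limit_of_tendsto:
  "(g \<longlongrightarrow> c) F \<Longrightarrow> uniform_limit S (\<lambda>t _. g t) (\<lambda>_. c) F"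
  by (auto simp: uniform_limit_iff tendsto_iff elim: eventually_mono)

text \<open>With \<open>y1 = u powr (a - 1) * N u\<close> and \<open>y0 = u powr a * D u\<close>,
  the relative error is \<open>(a0 * y1 - a1 * y0) / (a1 * y0)\<close>. The product
  \<open>a0 * a1\<close> cancels in the numerator, leaving a combination of the two second-order
  errors. The change of argument in \<open>A\<close> is absorbed by \<open>u powr \<rho> / A v = (u
  / v) powr \<rho> / (v powr (- \<rho>) * A v)\<close>.\<close>

lemma tendsto_quotient_of_expansions:
  fixes N D A :: "real \<Rightarrow> real"
  assumes N: "((\<lambda>u. u powr (- \<rho>) * (u powr (a - 1) * N u - a1)) \<longlongrightarrow> b1) at_top"
    and D: "((\<lambda>u. u powr (- \<rho>) * (u powr a * D u - a0)) \<longlongrightarrow> b0) at_top"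
    and A: "((\<lambda>t. t powr (- \<rho>) * A t) \<longlongrightarrow> c) at_top"
    and pos: "a0 > 0" "a1 > 0" "c \<noteq> 0" and rho: "\<rho> < 0"
    and u: "filterlim u at_top F" and v: "filterlim v at_top F"
    and uv: "((\<lambda>t. u t / v t) \<longlongrightarrow> k) F" "k > 0"
  shows "\<exists>l. ((\<lambda>t. (N (u t) / D (u t) / (u t * (a1 / a0)) - 1) / A (v t)) \<longlongrightarrow> l) F"
proof -
  have Dlim: "((\<lambda>u. u powr a * D u) \<longlongrightarrow> a0) at_top"
    using tendsto_of_scaled_tendsto[OF rho D] .
  define B1 where "B1 u = u powr (- \<rho>) * (u powr (a - 1) * N u - a1)" for u
  define B0 where "B0 u = u powr (- \<rho>) * (u powr a * D u - a0)" for u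
  have "((\<lambda>t. (a0 * B1 (u t) - a1 * B0 (u t)) / (a1 * (u t powr a * D (u t)))
      * ((u t / v t) powr \<rho> / (v t powr (- \<rho>) * A (v t))))
    \<longlongrightarrow> (a0 * b1 - a1 * b0) / (a1 * a0) * (k powr \<rho> / c)) F"
    unfolding B1_def B0_def
    by (intro tendsto_intros filterlim_compose[OF N u] filterlim_compose[OF D u]
        filterlim_compose[OF A v] filterlim_compose[OF Dlim u] uv) (use pos uv in auto)
  moreover have "\<forall>\<^sub>F t in F. (a0 * B1 (u t) - a1 * B0 (u t)) / (a1 * (u t powr a * D (u t)))
      * ((u t / v t) powr \<rho> / (v t powr (- \<rho>) * A (v t)))
    = (N (u t) / D (u t) / (u t * (a1 / a0)) - 1) / A (v t)"
  proof -
    have "\<forall>\<^sub>F t in F. u t > 0" "\<forall>\<^sub>F t in F. v t > 0"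
      using u v by (auto simp: filterlim_at_top_dense)
    moreover have "\<forall>\<^sub>F t in F. u t powr a * D (u t) > 0"
      by (rule order_tendstoD(1)[OF filterlim_compose[OF Dlim u] pos(1)])
    ultimately show ?thesis
    proof eventually_elim
      case (elim t)
      define x where "x = u t"
      define y where "y = v t"
      define y0 where "y0 = x powr a * D x"
      define y1 where "y1 = x powr (a - 1) * N x"
      have x: "x > 0" and y: "y > 0" and y0: "y0 > 0"
        using elim by (simp_all add: x_def y_def y0_def)
      have "x powr a = x * x powr (a - 1)"
        using x by (simp add: powr_diff)
      then have quot: "N x / D x / x = y1 / y0"
        using x y0 unfolding y0_def y1_def by (simp add: field_simps)
      have "(x / y) powr \<rho> / (y powr (- \<rho>) * A y) = x powr \<rho> / A y"
        using x y by (simp add: powr_divide powr_minus_divide)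
      moreover have "a0 * B1 x - a1 * B0 x = x powr (- \<rho>) * (a0 * y1 - a1 * y0)"
        unfolding B1_def B0_def y0_def y1_def by (simp add: algebra_simps)
      ultimately have "(a0 * B1 x - a1 * B0 x) / (a1 * y0) * ((x / y) powr \<rho> / (y powr (- \<rho>) * A y))
          = (x powr (- \<rho>) * x powr \<rho>) * ((a0 * y1 - a1 * y0) / (a1 * y0)) / A y"
        by simp
      also have "x powr (- \<rho>) * x powr \<rho> = 1"
        using x by (simp add: powr_minus)
      also have "(a0 * y1 - a1 * y0) / (a1 * y0) = N x / D x / x / (a1 / a0) - 1"
        unfolding quot using y0 pos by (simp add: field_simps)
      finally show ?case
        unfolding x_def y_def y0_def by (simp add: divide_divide_eq_left)
    qed
  qed
  ultimately show ?thesis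
    by (blast intro: Lim_transform_eventually)
qed

theorem theorem1:
  fixes M :: "'a measure" and X :: "'a \<Rightarrow> real^'d"
    and f :: "real^'d \<Rightarrow> real" and H :: "(real^'d) measure" and h :: "real^'d \<Rightarrow> real"
    and \<gamma> \<rho> :: real
    and A :: "'d \<Rightarrow> real \<Rightarrow> real"
    and lam :: "'d \<Rightarrow> real^'d \<Rightarrow> real"
    and q :: "'d \<Rightarrow> real^'d \<Rightarrow> real"
  defines "R \<equiv> (\<lambda>\<omega>. Rsum (X \<omega>))"
  defines "tailR \<equiv> (\<lambda>t. measure M {\<omega>\<in>space M. R \<omega> > t})"
  assumes M: "prob_space M"
    and X_meas: "X \<in> borel_measurable M"
    and X_nonneg: "\<forall>\<omega>\<in>space M. \<forall>j. 0 \<le> X \<omega> $ j"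
    and gamma: "0 < \<gamma>" "\<gamma> < 1"
    \<comment> \<open>F in RV(1/gamma): regular variation of the radial tail\<close>
    and RV: "\<forall>x>0. ((\<lambda>t. tailR (t * x) / tailR t) \<longlongrightarrow> x powr (- 1 / \<gamma>)) at_top"
    \<comment> \<open>angular measure H on S, weak limit of P(W in . | R > t)\<close>
    and H_prob: "prob_space H" and H_sets: "sets H = sets borel"
    and H_weak: "\<forall>g :: real^'d \<Rightarrow> real. continuous_on UNIV g \<and> bounded (range g) \<longrightarrow>
        ((\<lambda>t. cond_mean M (\<lambda>\<omega>. g ((1 / R \<omega>) *\<^sub>R X \<omega>)) {\<omega>\<in>space M. R \<omega> > t})
           \<longlongrightarrow> (\<integral>w. g w \<partial>H)) at_top"
    \<comment> \<open>density assumptions\<close>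
    and f_meas: "f \<in> borel_measurable borel" and f_nonneg: "\<forall>x. 0 \<le> f x"
    and f_dens: "distr M lborel X = density lborel (\<lambda>x. ennreal (f x))"
    and H_dens: "H = density simplex_measure (\<lambda>w. ennreal (h w))"
    and h_pos: "\<forall>w\<in>unit_simplex. 0 < h w"
    and h_cont: "continuous_on unit_simplex h" and h_bdd: "bounded (h ` unit_simplex)"
    and f_unif: "uniform_limit unit_simplex
        (\<lambda>t w. t ^ CARD('d) * f (t *\<^sub>R w) / tailR t) (\<lambda>w. h w / \<gamma>) at_top"
    \<comment> \<open>Condition 1\<close>
    and rho: "\<rho> < 0"
    and A_rate: "\<forall>j. \<exists>c. c \<noteq> 0 \<and> ((\<lambda>t. t powr (- \<rho>) * A j t) \<longlongrightarrow> c) at_top"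
    and A_2RV: "\<forall>j. \<forall>x>0. ((\<lambda>t. ((1 - cdf_rv M (\<lambda>\<omega>. X \<omega> $ j) (t * x))
                                   / (1 - cdf_rv M (\<lambda>\<omega>. X \<omega> $ j) t) - x powr (- 1 / \<gamma>))
                                  / A j t)
              \<longlongrightarrow> x powr (- 1 / \<gamma>) * (x powr \<rho> - 1) / \<rho>) at_top"
    and lam_nonnull: "\<forall>j. \<exists>x. (\<forall>i. 0 < x $ i) \<and> lam j x \<noteq> 0"
    and lam_int: "\<forall>j. \<forall>r>0. set_integrable lborel {x. (\<forall>i. 0 < x $ i) \<and> r \<le> Rsum x} (lam j)"
    and lam_bdd: "\<forall>j. bounded (lam j ` unit_simplex)"
    and q_form: "\<forall>j. \<exists>\<kappa>. \<forall>x. (\<forall>i. 0 \<le> x $ i) \<and> 0 < Rsum x \<longrightarrow>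
        q j x = \<kappa> * Rsum x powr (- real CARD('d) - 1 / \<gamma>) * h ((1 / Rsum x) *\<^sub>R x)"
    and lam_pw: "\<forall>j. \<forall>x. (\<forall>i. 0 < x $ i) \<longrightarrow>
        ((\<lambda>t. (t ^ CARD('d) * f (t *\<^sub>R x) / measure M {\<omega>\<in>space M. X \<omega> $ j > t} - q j x) / A j t)
           \<longlongrightarrow> lam j x) at_top"
    and lam_unif: "\<forall>j. uniform_limit unit_simplex
        (\<lambda>t w. (t ^ CARD('d) * f (t *\<^sub>R w) / measure M {\<omega>\<in>space M. X \<omega> $ j > t} - q j w) / A j t)
        (lam j) at_top"
  shows "\<forall>j. \<exists>c::real.
    ((\<lambda>t. (cond_mean M (\<lambda>\<omega>. X \<omega> $ j) {\<omega>\<in>space M. R \<omega> > quantile M R (1 - 1 / t)}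
             / (quantile M R (1 - 1 / t) * (\<integral>w. w $ j \<partial>H) / (1 - \<gamma>)) - 1)
          / A j (tailq M (\<lambda>\<omega>. X \<omega> $ j) t))
      \<longlongrightarrow> c) at_top"
proof
  fix j :: 'd
  interpret prob_space M by (rule M)
  interpret \<sigma>: finite_measure "simplex_measure :: (real^'d) measure" by (rule finite_measure_simplex)
  note [measurable] = X_meas f_meas
  define n where "n = real CARD('d)"
  define a where "a = 1 / \<gamma>"
  have a: "a > 1" using gamma by (simp add: a_def)

  \<comment> \<open>The tail of the component \<open>X_j\<close>\<close>
  define p where "p t = prob {\<omega>\<in>space M. X \<omega> $ j > t}" for t
  have Xj [measurable]: "(\<lambda>\<omega>. X \<omega> $ j) \<in> borel_measurable M"
    using measurable_compose[OF X_meas borel_measurable_component] .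
  have R_meas [measurable]: "R \<in> borel_measurable M" unfolding R_def by measurable
  have p_cdf: "1 - cdf_rv M (\<lambda>\<omega>. X \<omega> $ j) t = p t" for t
    by (simp add: cdf_rv_eq[OF Xj] p_def)
  have p_le: "p t \<le> tailR t" for t
    unfolding p_def tailR_def
  proof (rule finite_measure_mono)
    have "X \<omega> $ j \<le> R \<omega>" if "\<omega> \<in> space M" for \<omega>
      unfolding R_def Rsum_def by (rule member_le_sum) (use X_nonneg that in auto)
    then show "{\<omega> \<in> space M. t < X \<omega> $ j} \<subseteq> {\<omega> \<in> space M. t < R \<omega>}" by force
  qed measurable
  obtain c where c: "c \<noteq> 0" "((\<lambda>t. t powr (- \<rho>) * A j t) \<longlongrightarrow> c) at_top"
    using A_rate by blast
  have A0: "(A j \<longlongrightarrow> 0) at_top"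
  proof -
    have "((\<lambda>t. t powr \<rho> * (t powr (- \<rho>) * A j t)) \<longlongrightarrow> 0 * c) at_top"
      by (intro tendsto_mult c tendsto_neg_powr[OF rho filterlim_ident])
    then have "((\<lambda>t. t powr \<rho> * (t powr (- \<rho>) * A j t)) \<longlongrightarrow> 0) at_top" by simp
    then show ?thesis
      by (rule Lim_transform_eventually)
         (use eventually_gt_at_top[of 0] in \<open>eventually_elim, simp add: powr_minus flip: mult.assoc\<close>)
  qed
  have A_ne: "\<forall>\<^sub>F t in at_top. A j t \<noteq> 0"
    using tendsto_imp_eventually_ne[OF c(2,1)] by eventually_elim auto
  have sec: "((\<lambda>t. (p (t * x) / p t - x powr (- a)) / A j t) \<longlongrightarrow> x powr (- a) * (x powr \<rho> - 1) / \<rho>) at_top"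
    if "x > 0" for x
    using A_2RV[rule_format, where j = j, OF that] by (simp add: p_cdf a_def)
  \<comment> \<open>A zero of \<open>p\<close> would persist to the right by monotonicity. Then
    \<open>p s / p s = 0 / 0 = 0\<close>, so at \<open>x = 1\<close> the numerator in
    \<open>sec\<close> is eventually -1, whereas it must tend to 0 with \<open>A j\<close>.\<close>
  have p_pos: "p t > 0" for t
  proof (rule ccontr)
    assume "\<not> p t > 0"
    then have "p t = 0" unfolding p_def by (simp add: zero_less_measure_iff)
    have "\<forall>\<^sub>F s in at_top. (p (s * 1) / p s - 1 powr (- a)) / A j s * A j s = -1"
      using eventually_ge_at_top[of t] A_ne
    proof eventually_elim
      case (elim s)
      have "p s \<le> p t" unfolding p_def by (rule finite_measure_mono) (use elim in auto)
      then have "p s = 0" using \<open>p t = 0\<close> unfolding p_def by (simp add: measure_le_0_iff)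
      then show ?case using elim by simp
    qed
    moreover have "((\<lambda>s. (p (s * 1) / p s - 1 powr (- a)) / A j s * A j s)
        \<longlongrightarrow> 1 powr (- a) * (1 powr \<rho> - 1) / \<rho> * 0) at_top"
      by (intro tendsto_mult sec A0) simp
    ultimately have "((\<lambda>_::real. -1 :: real) \<longlongrightarrow> 1 powr (- a) * (1 powr \<rho> - 1) / \<rho> * 0) at_top"
      by (rule Lim_transform_eventually[rotated])
    then show False by (simp add: tendsto_const_iff)
  qed
  obtain C b where C: "C > 0" and b: "((\<lambda>t. t powr (- \<rho>) * (t powr a * p t - C)) \<longlongrightarrow> b) at_top"
    using second_order_tail_expansion[OF rho always_eventually c(2,1) sec] p_pos by blast
  have pC: "((\<lambda>t. t powr a * p t) \<longlongrightarrow> C) at_top"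
    using tendsto_of_scaled_tendsto[OF rho b] .

  \<comment> \<open>The angular density and the mean angle\<close>
  obtain \<kappa> where \<kappa>: "\<forall>x. (\<forall>i. 0 \<le> x $ i) \<and> 0 < Rsum x \<longrightarrow>
      q j x = \<kappa> * Rsum x powr (- real CARD('d) - 1 / \<gamma>) * h ((1 / Rsum x) *\<^sub>R x)"
    using q_form by blast
  have q: "q j w = \<kappa> * h w" if "w \<in> unit_simplex" for w
    using \<kappa>[rule_format, of w] that by (auto simp: unit_simplex_def)
  \<comment> \<open>\<open>h\<close> is continuous on the simplex and arbitrary elsewhere; extension
    by zero makes it Borel on the whole space and nonnegative without changing
    \<open>H\<close>.\<close>
  define hs where "hs w = indicator unit_simplex w * h w" for w
  have hs_meas [measurable]: "hs \<in> borel_measurable borel"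
    using borel_measurable_continuous_on_indicator[OF sets_unit_simplex h_cont]
    by (simp add: hs_def[abs_def])
  have hs_nn: "hs w \<ge> 0" for w
    using h_pos by (auto simp: hs_def indicator_def intro: less_imp_le)
  have hs_eq: "hs w = h w" if "w \<in> unit_simplex" for w using that by (simp add: hs_def)
  have hs_bdd: "bounded ((\<lambda>w. k * hs w) ` unit_simplex)" for k
    using bounded_scaling[OF h_bdd, of k] by (simp add: image_image hs_eq cong: image_cong)
  have H_eq: "H = density simplex_measure (\<lambda>w. ennreal (hs w))"
  proof -
    have "(\<integral>\<^sup>+w. ennreal (h w) * indicator B w \<partial>simplex_measure)
        = (\<integral>\<^sup>+w. ennreal (hs w) * indicator B w \<partial>simplex_measure)" for B
      by (intro nn_integral_cong_AE) (use AE_simplex_measure hs_eq in \<open>auto elim: eventually_mono\<close>)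
    then show ?thesis unfolding H_dens density_def by simp
  qed
  define wb where "wb = (\<integral>w. w $ j \<partial>H)"
  have wb: "(\<integral>w. w $ j * hs w \<partial>simplex_measure) = wb"
    unfolding wb_def H_eq using hs_nn by (subst integral_density) (auto simp: mult.commute)
  have hs_1: "(\<integral>w. hs w \<partial>simplex_measure) = 1"
  proof -
    have "(\<integral>w. hs w \<partial>simplex_measure) = (\<integral>w. 1 \<partial>H)"
      unfolding H_eq using hs_nn by (subst integral_density) auto
    then show ?thesis using prob_space.prob_space[OF H_prob] by simp
  qed
  have coord: "0 \<le> w $ j" "w $ j \<le> 1" if "w \<in> unit_simplex" for w
  proof -
    have "w $ j \<le> Rsum w"
      unfolding Rsum_def by (rule member_le_sum) (use that in \<open>auto simp: unit_simplex_def\<close>)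
    then show "0 \<le> w $ j" "w $ j \<le> 1" using that by (auto simp: unit_simplex_def)
  qed
  have coord_bdd: "bounded ((\<lambda>w. w $ j) ` unit_simplex)"
    unfolding bounded_iff using coord by (intro exI[of _ 1]) auto
  have bounded_mult: "bounded ((\<lambda>w. k w * l w) ` unit_simplex)"
    if "bounded (k ` unit_simplex)" "bounded (l ` unit_simplex)" for k l :: "real^'d \<Rightarrow> real"
  proof -
    obtain K L where "\<And>w. w \<in> unit_simplex \<Longrightarrow> \<bar>k w\<bar> \<le> K" "\<And>w. w \<in> unit_simplex \<Longrightarrow> \<bar>l w\<bar> \<le> L"
      using \<open>bounded (k ` unit_simplex)\<close> \<open>bounded (l ` unit_simplex)\<close> unfolding bounded_iff by auto
    then have "\<bar>k w * l w\<bar> \<le> K * L" if "w \<in> unit_simplex" for w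
      unfolding abs_mult using that by (intro mult_mono) (auto intro: order_trans[OF abs_ge_zero])
    then show ?thesis unfolding bounded_iff by auto
  qed
  have wb_pos: "wb > 0"
  proof -
    have bdd: "bounded ((\<lambda>w. w $ j * hs w) ` unit_simplex)"
      using bounded_mult[OF coord_bdd hs_bdd[of 1]] by simp
    then obtain K where K: "\<And>w. w \<in> unit_simplex \<Longrightarrow> \<bar>w $ j * hs w\<bar> \<le> K"
      unfolding bounded_iff by auto
    have int: "integrable simplex_measure (\<lambda>w. w $ j * hs w)"
      by (rule \<sigma>.integrable_const_bound[of _ K])
         (use AE_simplex_measure K in \<open>auto elim: eventually_mono\<close>)
    have nn: "AE w in simplex_measure. 0 \<le> w $ j * hs w"
      using AE_simplex_measure by eventually_elim (use coord hs_nn in auto)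
    have "wb \<noteq> 0"
    proof
      assume "wb = 0"
      then have "AE w in simplex_measure. w $ j * hs w = 0"
        using integral_nonneg_eq_0_iff_AE[OF int nn] wb by simp
      then have "AE w in simplex_measure. \<not> 0 < w $ j"
        using AE_simplex_measure by eventually_elim (use h_pos in \<open>auto simp: hs_def\<close>)
      moreover have "{w :: real^'d. 0 < w $ j} \<in> sets borel"
        by (intro borel_open open_Collect_less continuous_intros)
      ultimately have "emeasure simplex_measure {w :: real^'d. 0 < w $ j} = 0"
        by (subst (asm) AE_iff_measurable[OF _ refl]) auto
      then show False using emeasure_simplex_coordinate_pos by blast
    qed
    moreover have "wb \<ge> 0" unfolding wb[symmetric] using nn by (rule integral_nonneg_AE)
    ultimately show ?thesis by simp
  qed

  \<comment> \<open>Uniform second-order expansion of the density\<close>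
  define g where "g w = b * (\<kappa> * hs w) + C * c * lam j w" for w
  have g_bdd: "bounded (g ` unit_simplex)"
    unfolding g_def using hs_bdd[of "b * \<kappa>"] bounded_scaling[OF lam_bdd[rule_format, of j], of "C * c"]
    by (intro bounded_plus_comp) (simp_all add: mult.assoc image_image)
  \<comment> \<open>Replacing \<open>p t\<close> by its expansion in
    \<open>p t * (\<kappa> * hs w)\<close> contributes the coefficient
    \<open>b * \<kappa> * hs w\<close>. The error in Condition 1(b), rescaled by
    \<open>t powr a * p t\<close> and \<open>t powr (- \<rho>) * A j t\<close>, contributes
    \<open>C * c * lam j w\<close>. Their sum is \<open>g\<close>.\<close>
  have lim: "uniform_limit unit_simplex
      (\<lambda>t w. t powr (- \<rho>) * (t powr (n + a) * f (t *\<^sub>R w) - C * \<kappa> * hs w)) g at_top"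
  proof -
    let ?L = "\<lambda>t w. (t ^ CARD('d) * f (t *\<^sub>R w) / p t - q j w) / A j t"
    have "uniform_limit unit_simplex (\<lambda>t w. t powr a * p t * (t powr (- \<rho>) * A j t) * ?L t w)
        (\<lambda>w. C * c * lam j w) at_top"
      using lam_unif lam_bdd
      by (intro uniform_lim_mult[OF uniform_limit_of_tendsto[OF tendsto_mult[OF pC c(2)]]])
         (auto simp: p_def bounded_iff)
    moreover have "uniform_limit unit_simplex
        (\<lambda>t w. t powr (- \<rho>) * (t powr a * p t - C) * (\<kappa> * hs w)) (\<lambda>w. b * (\<kappa> * hs w)) at_top"
      by (intro uniform_lim_mult[OF uniform_limit_of_tendsto[OF b] uniform_limit_const] hs_bdd)
         (auto simp: bounded_iff)
    ultimately have "uniform_limit unit_simplex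
      (\<lambda>t w. (t powr (- \<rho>) * (t powr a * p t - C)) * (\<kappa> * hs w)
        + (t powr a * p t * (t powr (- \<rho>) * A j t)) * ?L t w) g at_top"
      unfolding g_def by (intro uniform_limit_add)
    moreover have "\<forall>\<^sub>F t in at_top. \<forall>w\<in>unit_simplex.
        (t powr (- \<rho>) * (t powr a * p t - C)) * (\<kappa> * hs w)
        + (t powr a * p t * (t powr (- \<rho>) * A j t)) * ?L t w
        = t powr (- \<rho>) * (t powr (n + a) * f (t *\<^sub>R w) - C * \<kappa> * hs w)"
      using A_ne eventually_gt_at_top[of 0]
    proof eventually_elim
      case (elim t)
      have pn: "t powr (n + a) = t ^ CARD('d) * t powr a"
        using elim by (simp add: n_def powr_add powr_realpow)
      have L: "p t * A j t * ?L t w = t ^ CARD('d) * f (t *\<^sub>R w) - p t * (\<kappa> * hs w)"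
        if "w \<in> unit_simplex" for w
        using elim p_pos[of t] by (simp add: q[OF that] hs_eq[OF that] field_simps)
      show ?case
      proof
        fix w :: "real^'d" assume w: "w \<in> unit_simplex"
        have "(t powr a * p t * (t powr (- \<rho>) * A j t)) * ?L t w
            = t powr a * t powr (- \<rho>) * (p t * A j t * ?L t w)" by (simp only: mult_ac)
        then show "(t powr (- \<rho>) * (t powr a * p t - C)) * (\<kappa> * hs w)
            + (t powr a * p t * (t powr (- \<rho>) * A j t)) * ?L t w
            = t powr (- \<rho>) * (t powr (n + a) * f (t *\<^sub>R w) - C * \<kappa> * hs w)"
          unfolding L[OF w] pn by (simp add: algebra_simps)
      qed
    qed
    ultimately show ?thesis
      by (subst (asm) uniform_limit_cong) auto
  qed
  \<comment> \<open>The \<open>j\<close>-th coordinate of \<open>t *\<^sub>R w\<close> carries one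
    factor \<open>t\<close>, so the same expansion holds with \<open>a - 1\<close> in place of
    \<open>a\<close>.\<close>
  have lim_j: "uniform_limit unit_simplex
      (\<lambda>t w. t powr (- \<rho>) * (t powr (n + (a - 1)) * ((t *\<^sub>R w) $ j * f (t *\<^sub>R w)) - w $ j * (C * \<kappa> * hs w)))
      (\<lambda>w. w $ j * g w) at_top"
  proof -
    have "uniform_limit unit_simplex
      (\<lambda>t w. w $ j * (t powr (- \<rho>) * (t powr (n + a) * f (t *\<^sub>R w) - C * \<kappa> * hs w))) (\<lambda>w. w $ j * g w) at_top"
      by (intro uniform_lim_mult uniform_limit_const lim coord_bdd g_bdd)
    moreover have "\<forall>\<^sub>F t in at_top. \<forall>w\<in>unit_simplex.
        w $ j * (t powr (- \<rho>) * (t powr (n + a) * f (t *\<^sub>R w) - C * \<kappa> * hs w))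
        = t powr (- \<rho>) * (t powr (n + (a - 1)) * ((t *\<^sub>R w) $ j * f (t *\<^sub>R w)) - w $ j * (C * \<kappa> * hs w))"
      using eventually_gt_at_top[of 0]
    proof eventually_elim
      case (elim t)
      have "t powr (n + a) = t powr (n + (a - 1)) * t"
        using elim powr_add[of t "n + (a - 1)" 1] by simp
      then show ?case by (simp add: algebra_simps)
    qed
    ultimately show ?thesis
      by (subst (asm) uniform_limit_cong) auto
  qed

  \<comment> \<open>Tail probability and truncated mean as Lebesgue integrals\<close>
  have transfer: "(\<integral>\<omega>. indicator {\<omega>\<in>space M. R \<omega> > u} \<omega> * \<psi> (X \<omega>) \<partial>M)
      = (\<integral>x. indicator (orthant_tail u) x * (\<psi> x * f x) \<partial>lborel)"
    if [measurable]: "\<psi> \<in> borel_measurable borel" for \<psi> :: "real^'d \<Rightarrow> real" and u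
  proof -
    have "(\<integral>\<omega>. indicator {\<omega>\<in>space M. R \<omega> > u} \<omega> * \<psi> (X \<omega>) \<partial>M)
        = (\<integral>\<omega>. indicator (orthant_tail u) (X \<omega>) * \<psi> (X \<omega>) \<partial>M)"
      by (intro Bochner_Integration.integral_cong)
         (use X_nonneg in \<open>auto simp: R_def orthant_tail_def indicator_def\<close>)
    also have "\<dots> = (\<integral>x. indicator (orthant_tail u) x * \<psi> x \<partial>distr M lborel X)"
      by (subst integral_distr) auto
    also have "\<dots> = (\<integral>x. f x *\<^sub>R (indicator (orthant_tail u) x * \<psi> x) \<partial>lborel)"
      unfolding f_dens using f_nonneg by (subst integral_density) auto
    finally show ?thesis by (simp add: mult_ac)
  qed
  define N where "N u = (\<integral>\<omega>. indicator {\<omega>\<in>space M. R \<omega> > u} \<omega> * X \<omega> $ j \<partial>M)" for u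
  have N_eq: "N u = (\<integral>x. indicator (orthant_tail u) x * (x $ j * f x) \<partial>lborel)" for u
    unfolding N_def by (rule transfer) measurable
  have tailR_eq: "tailR u = (\<integral>x. indicator (orthant_tail u) x * f x \<partial>lborel)" for u
  proof -
    have "tailR u = (\<integral>\<omega>. indicator {\<omega>\<in>space M. R \<omega> > u} \<omega> * 1 \<partial>M)"
      unfolding tailR_def by simp
    also have "\<dots> = (\<integral>x. indicator (orthant_tail u) x * (1 * f x) \<partial>lborel)"
      by (rule transfer) measurable
    finally show ?thesis by simp
  qed
  \<comment> \<open>These are the leading coefficients of \<open>tailR\<close> and \<open>N\<close>:
    the cone integral of \<open>hs\<close> is 1, that of \<open>w $ j * hs w\<close> is
    \<open>wb\<close>, and the radial integrals contribute \<open>1 / a\<close> and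
    \<open>1 / (a - 1)\<close>.\<close>
  define a0 where "a0 = C * \<kappa> / a"
  define a1 where "a1 = C * \<kappa> * wb / (a - 1)"
  obtain b0 where b0: "((\<lambda>u. u powr (- \<rho>) * (u powr a * tailR u - a0)) \<longlongrightarrow> b0) at_top"
  proof -
    have "(\<integral>w. C * \<kappa> * hs w \<partial>simplex_measure) / a = a0"
      by (simp add: hs_1 a0_def)
    then show ?thesis
      using that tail_integral_expansion[OF _ rho f_meas _ hs_bdd g_bdd, where a = a] a lim
      unfolding tailR_eq n_def by auto
  qed
  obtain b1 where b1: "((\<lambda>u. u powr (- \<rho>) * (u powr (a - 1) * N u - a1)) \<longlongrightarrow> b1) at_top"
  proof -
    have "(\<integral>w. w $ j * (C * \<kappa> * hs w) \<partial>simplex_measure) = (\<integral>w. C * \<kappa> * (w $ j * hs w) \<partial>simplex_measure)"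
      by (simp add: mult_ac)
    also have "\<dots> = C * \<kappa> * wb" by (simp only: integral_mult_right_zero wb)
    finally have "(\<integral>w. w $ j * (C * \<kappa> * hs w) \<partial>simplex_measure) / (a - 1) = a1"
      by (simp add: a1_def)
    moreover have "\<exists>b. ((\<lambda>u. u powr (- \<rho>) * (u powr (a - 1) *
        (\<integral>x. indicator (orthant_tail u) x * (x $ j * f x) \<partial>lborel)
        - (\<integral>w. w $ j * (C * \<kappa> * hs w) \<partial>simplex_measure) / (a - 1))) \<longlongrightarrow> b) at_top"
      by (rule tail_integral_expansion[OF _ rho _ _ _ _ lim_j[unfolded n_def]])
         (use a in \<open>auto intro!: bounded_mult coord_bdd hs_bdd g_bdd\<close>)
    ultimately show ?thesis using that unfolding N_eq by auto
  qed
  have tail_lim: "((\<lambda>u. u powr a * tailR u) \<longlongrightarrow> a0) at_top"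
    using tendsto_of_scaled_tendsto[OF rho b0] .
  \<comment> \<open>Proportionality of \<open>q j\<close> does not fix the sign of \<kappa>. Since
    \<open>X_j\<close> never exceeds \<open>R\<close>, comparing the two scaled tails gives
    \<open>a0 \<ge> C > 0\<close>, and therefore \<open>\<kappa> > 0\<close>.\<close>
  have "a0 \<ge> C"
    by (rule tendsto_le[OF _ tail_lim pC]) (auto intro!: always_eventually mult_left_mono p_le)
  then have a0: "a0 > 0" using C by simp
  then have "C * \<kappa> > 0" using a unfolding a0_def by (simp add: zero_less_divide_iff)
  then have a1: "a1 > 0" using a wb_pos unfolding a1_def by simp
  have slope: "a1 / a0 = wb / (1 - \<gamma>)"
  proof -
    have "a / (a - 1) = 1 / (1 - \<gamma>)" using gamma by (simp add: a_def field_simps)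
    moreover have "(x * wb / (a - 1)) / (x / a) = wb * (a / (a - 1))" if "x > 0" for x
      using that by simp
    then have "a1 / a0 = wb * (a / (a - 1))"
      using \<open>C * \<kappa> > 0\<close> unfolding a0_def a1_def by blast
    ultimately show ?thesis by simp
  qed

  \<comment> \<open>Quantiles of \<open>R\<close> and of \<open>X_j\<close>, and the
    conclusion\<close>
  define u where "u t = tailq M R t" for t
  define v where "v t = tailq M (\<lambda>\<omega>. X \<omega> $ j) t" for t
  have u_lim: "((\<lambda>t. u t / t powr \<gamma>) \<longlongrightarrow> a0 powr \<gamma>) at_top"
    unfolding u_def
  proof (rule tailq_asymp[OF R_meas _ gamma(1) a0])
    show "R \<omega> \<ge> 0" if "\<omega> \<in> space M" for \<omega>
      unfolding R_def Rsum_def by (intro sum_nonneg) (use X_nonneg that in auto)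
    show "((\<lambda>x. x powr (1 / \<gamma>) * prob {\<omega> \<in> space M. x < R \<omega>}) \<longlongrightarrow> a0) at_top"
      using tail_lim unfolding tailR_def a_def .
  qed
  have v_lim: "((\<lambda>t. v t / t powr \<gamma>) \<longlongrightarrow> C powr \<gamma>) at_top"
    unfolding v_def
  proof (rule tailq_asymp[OF Xj _ gamma(1) C])
    show "((\<lambda>x. x powr (1 / \<gamma>) * prob {\<omega> \<in> space M. x < X \<omega> $ j}) \<longlongrightarrow> C) at_top"
      using pC unfolding p_def a_def .
  qed (use X_nonneg in auto)
  have at_top: "filterlim y at_top at_top"
    if "((\<lambda>t. y t / t powr \<gamma>) \<longlongrightarrow> l) at_top" "l > 0" for y :: "real \<Rightarrow> real" and l
  proof -
    have "filterlim (\<lambda>t. y t / t powr \<gamma> * t powr \<gamma>) at_top at_top"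
      by (rule filterlim_tendsto_pos_mult_at_top[OF that filterlim_powr_at_top[OF gamma(1)]])
    moreover have "\<forall>\<^sub>F t in at_top. y t / t powr \<gamma> * t powr \<gamma> = y t"
      using eventually_gt_at_top[of 0] by eventually_elim simp
    ultimately show ?thesis by (simp cong: filterlim_cong)
  qed
  have uv: "((\<lambda>t. u t / v t) \<longlongrightarrow> a0 powr \<gamma> / C powr \<gamma>) at_top"
  proof -
    have "((\<lambda>t. (u t / t powr \<gamma>) / (v t / t powr \<gamma>)) \<longlongrightarrow> a0 powr \<gamma> / C powr \<gamma>) at_top"
      by (intro tendsto_divide u_lim v_lim) (use C in simp)
    then show ?thesis
      by (rule Lim_transform_eventually) (use eventually_gt_at_top[of 0] in \<open>eventually_elim, simp\<close>)
  qed
  obtain l where l: "((\<lambda>t. (N (u t) / tailR (u t) / (u t * (a1 / a0)) - 1) / A j (v t)) \<longlongrightarrow> l) at_top"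
    using tendsto_quotient_of_expansions[OF b1 b0 c(2) a0 a1 c(1) rho at_top[OF u_lim] at_top[OF v_lim] uv]
      a0 C by auto
  \<comment> \<open>At level \<open>1 - 1 / t\<close> the quantile of \<open>R\<close> unfolds to
    \<open>tailq M R (1 / (1 / t))\<close>, which is \<open>u t\<close>; \<open>slope\<close>
    identifies the normalising constant.\<close>
  show "\<exists>c::real.
    ((\<lambda>t. (cond_mean M (\<lambda>\<omega>. X \<omega> $ j) {\<omega>\<in>space M. R \<omega> > quantile M R (1 - 1 / t)}
             / (quantile M R (1 - 1 / t) * (\<integral>w. w $ j \<partial>H) / (1 - \<gamma>)) - 1)
          / A j (tailq M (\<lambda>\<omega>. X \<omega> $ j) t))
      \<longlongrightarrow> c) at_top"
    using l by (intro exI[of _ l])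
      (simp add: quantile_def cond_mean_def slope wb_def N_def tailR_def u_def v_def)
qed

end
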